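(* Let $m,n,p,q$ be integers with $0\le m\le q$, $0\le n\le p$, let $a_i,b_j\in\mathbb{C}$ and $\alpha_i,\beta_j>0$ ($1\le i\le p$, $1\le j\le q$), and let $\mathcal H(s)$, $\Delta$, $\delta$, $H^{m,n}_{p,q}(z)$, $a_{ik}$, $N_{ik}$, $h_{ik}$, $H_{ikj}$ be as defined in the context. Let the conditions $$\beta_j(a_i-1-k)\ne\alpha_i(b_j+l)\qquad(i=1,\dots,n;\ j=1,\dots,m;\ k,l\in\mathbb N_0)$$ be satisfied and let either $\Delta<0$, $z\ne0$ or $\Delta=0$, $|z|>\delta$. Then the $H$-function has the power-logarithmic series expansion $$H^{m,n}_{p,q}(z)={\sum_{i,k}}'\,h_{ik}\,z^{(a_i-1-k)/\alpha_i}+{\sum_{i,k}}''\,\sum_{j=0}^{N_{ik}-1}H_{ikj}\,z^{(a_i-1-k)/\alpha_i}[\log z]^j .$$ Here $\sum'$ and $\sum''$ are summations taken over $i,k$ ($i=1,\dots,n$; $k=0,1,\dots$) such that the Gamma-functions $\Gamma(1-a_i-\alpha_is)$ have simple poles and poles of order $N_{ik}$ at the points $a_{ik}$, respectively.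
   Context: $\mathbb N_0=\{0,1,2,\dots\}$. Definitions (empty products equal $1$): $$\mathcal H(s)=\frac{\prod_{j=1}^m\Gamma(b_j+\beta_js)\ \prod_{i=1}^n\Gamma(1-a_i-\alpha_is)}{\prod_{i=n+1}^p\Gamma(a_i+\alpha_is)\ \prod_{j=m+1}^q\Gamma(1-b_j-\beta_js)},\qquad \Delta=\sum_{j=1}^q\beta_j-\sum_{i=1}^p\alpha_i,\qquad \delta=\prod_{i=1}^p\alpha_i^{-\alpha_i}\prod_{j=1}^q\beta_j^{\beta_j},$$ $$H^{m,n}_{p,q}(z)=\frac1{2\pi i}\int_{\mathfrak L_{+\infty}}\mathcal H(s)z^{-s}\,ds ,$$ where the contour $\mathfrak L_{+\infty}$ runs from $+\infty+i\varphi_1$ to $+\infty+i\varphi_2$, $\varphi_1<\varphi_2$, such that the poles of $\Gamma(b_j+\beta_js)$ ($j=1,\dots,m$) lie on the left of $\mathfrak L_{+\infty}$ and those of $\Gamma(1-a_i-\alpha_is)$ ($i=1,\dots,n$) on the right of $\mathfrak L_{+\infty}$. For $i=1,\dots,n$ and $k\in\mathbb N_0$ put $a_{ik}=(1-a_i+k)/\alpha_i$. If no other of the Gamma-functions $\Gamma(1-a_r-\alpha_rs)$ ($r=1,\dots,n$) has a pole at $a_{ik}$, the pole is simple and $$h_{ik}=\frac{(-1)^k}{k!\,\alpha_i}\ \frac{\prod_{j=1}^m\Gamma\!\left(b_j+[1-a_i+k]\frac{\beta_j}{\alpha_i}\right)\prod_{j=1,\,j\ne i}^n\Gamma\!\left(1-a_j-[1-a_i+k]\frac{\alpha_j}{\alpha_i}\right)}{\prod_{j=n+1}^p\Gamma\!\left(a_j+[1-a_i+k]\frac{\alpha_j}{\alpha_i}\right)\prod_{j=m+1}^q\Gamma\!\left(1-b_j-[1-a_i+k]\frac{\beta_j}{\alpha_i}\right)}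 .$$ If some poles of the $\Gamma(1-a_r-\alpha_rs)$ ($r=1,\dots,n$) coincide at $a=a_{ik}$, then $N=N_{ik}$ denotes the order of this pole: there exist $i_1,\dots,i_N\in\{1,\dots,n\}$ and $k_{i_1},\dots,k_{i_N}\in\mathbb N_0$ such that $$a=a_{ik}=\frac{1-a_{i_1}+k_{i_1}}{\alpha_{i_1}}=\cdots=\frac{1-a_{i_N}+k_{i_N}}{\alpha_{i_N}} .$$ In this case set $$\mathcal H_1(s)=(s-a)^{N}\prod_{r\in\{i_1,\dots,i_N\}}\Gamma(1-a_r-\alpha_rs),\qquad \mathcal H_2(s)=\frac{\mathcal H(s)}{\prod_{r\in\{i_1,\dots,i_N\}}\Gamma(1-a_r-\alpha_rs)},$$ and, for $0\le j\le N_{ik}-1$, $$H_{ikj}=\frac1{(N_{ik}-1)!}\sum_{\nu=j}^{N_{ik}-1}(-1)^j\binom{N_{ik}-1}{\nu}\binom{\nu}{j}\,\mathcal H_1^{(N_{ik}-1-\nu)}(a_{ik})\,\mathcal H_2^{(\nu-j)}(a_{ik}),$$ where $f^{(r)}$ denotes the $r$-th derivative of $f$ (with $\mathcal H_1,\mathcal H_2$ extended analytically to $s=a$).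
   Formalization: The printed H_ikj lacks a factor −1, restored here; in Σ'' each multiple pole is counted once; the series converges as partial sums over Re a_ik<X with X→∞ keeping a fixed distance from all Re a_ik, and unconditionally if distinct poles are uniformly separated. *)

theory Defs
  imports "HOL-Complex_Analysis.Complex_Analysis"
begin

text \<open>
  Parameters: \<open>a i\<close>, \<open>\<alpha> i\<close> are used for \<open>1 \<le> i \<le> p\<close> and \<open>b j\<close>, \<open>\<beta> j\<close> for \<open>1 \<le> j \<le> q\<close>.
  Since \<open>Gamma\<close> is 0 at its poles and \<open>x / 0 = 0\<close>, a Gamma-function in a denominator
  contributes the value 0 of the entire function \<open>1 / \<Gamma>\<close> at its poles, as it should.
\<close>

definition fox_kernel ::
  "nat \<Rightarrow> nat \<Rightarrow> nat \<Rightarrow> nat \<Rightarrow> (nat \<Rightarrow> complex) \<Rightarrow> (nat \<Rightarrow> real) \<Rightarrow>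
   (nat \<Rightarrow> complex) \<Rightarrow> (nat \<Rightarrow> real) \<Rightarrow> complex \<Rightarrow> complex" where
  "fox_kernel m n p q a \<alpha> b \<beta> s =
     (\<Prod>j=1..m. Gamma (b j + of_real (\<beta> j) * s)) *
     (\<Prod>i=1..n. Gamma (1 - a i - of_real (\<alpha> i) * s)) /
     ((\<Prod>i=n+1..p. Gamma (a i + of_real (\<alpha> i) * s)) *
      (\<Prod>j=m+1..q. Gamma (1 - b j - of_real (\<beta> j) * s)))"

definition fox_Delta :: "nat \<Rightarrow> nat \<Rightarrow> (nat \<Rightarrow> real) \<Rightarrow> (nat \<Rightarrow> real) \<Rightarrow> real" where
  "fox_Delta p q \<alpha> \<beta> = (\<Sum>j=1..q. \<beta> j) - (\<Sum>i=1..p. \<alpha> i)"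

definition fox_delta :: "nat \<Rightarrow> nat \<Rightarrow> (nat \<Rightarrow> real) \<Rightarrow> (nat \<Rightarrow> real) \<Rightarrow> real" where
  "fox_delta p q \<alpha> \<beta> = (\<Prod>i=1..p. \<alpha> i powr (- \<alpha> i)) * (\<Prod>j=1..q. \<beta> j powr \<beta> j)"

definition fox_a_pole :: "(nat \<Rightarrow> complex) \<Rightarrow> (nat \<Rightarrow> real) \<Rightarrow> nat \<Rightarrow> nat \<Rightarrow> complex" where
  "fox_a_pole a \<alpha> i k = (1 - a i + of_nat k) / of_real (\<alpha> i)"

definition fox_b_pole :: "(nat \<Rightarrow> complex) \<Rightarrow> (nat \<Rightarrow> real) \<Rightarrow> nat \<Rightarrow> nat \<Rightarrow> complex" where
  "fox_b_pole b \<beta> j l = - (b j + of_nat l) / of_real (\<beta> j)"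

text \<open>
  A path \<open>g\<close> represents the infinite contour that comes in from \<open>+\<infinity> + i \<phi>\<^sub>1\<close> along the
  horizontal half-line to \<open>pathstart g\<close>, follows \<open>g\<close>, and leaves along the horizontal
  half-line from \<open>pathfinish g\<close> to \<open>+\<infinity> + i \<phi>\<^sub>2\<close>; here \<open>\<phi>\<^sub>1 = Im (pathstart g)\<close> and
  \<open>\<phi>\<^sub>2 = Im (pathfinish g)\<close>. \<open>closed_loop g X\<close> is this contour cut off at the abscissa \<open>X\<close>
  and closed by a vertical segment.
\<close>

definition closed_loop :: "(real \<Rightarrow> complex) \<Rightarrow> real \<Rightarrow> real \<Rightarrow> complex" where
  "closed_loop g X =
     linepath (Complex X (Im (pathstart g))) (pathstart g) +++ g +++
     linepath (pathfinish g) (Complex X (Im (pathfinish g))) +++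
     linepath (Complex X (Im (pathfinish g))) (Complex X (Im (pathstart g)))"

definition is_right_loop :: "(real \<Rightarrow> complex) \<Rightarrow> bool" where
  "is_right_loop g \<longleftrightarrow>
     valid_path g \<and> Im (pathstart g) < Im (pathfinish g) \<and>
     (\<forall>\<^sub>F X in at_top. simple_path (closed_loop g X))"

text \<open>
  As \<open>\<phi>\<^sub>1 < \<phi>\<^sub>2\<close>, the closed loops run clockwise: the points on the right of the contour are
  those encircled by it, and the points on the left are those outside.
\<close>

definition right_of_loop :: "(real \<Rightarrow> complex) \<Rightarrow> complex \<Rightarrow> bool" where
  "right_of_loop g w \<longleftrightarrow>
     (\<forall>\<^sub>F X in at_top. w \<notin> path_image (closed_loop g X) \<and> winding_number (closed_loop g X) w = -1)"

definition left_of_loop :: "(real \<Rightarrow> complex) \<Rightarrow> complex \<Rightarrow> bool" where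
  "left_of_loop g w \<longleftrightarrow>
     (\<forall>\<^sub>F X in at_top. w \<notin> path_image (closed_loop g X) \<and> winding_number (closed_loop g X) w = 0)"

definition loop_integrable :: "(complex \<Rightarrow> complex) \<Rightarrow> (real \<Rightarrow> complex) \<Rightarrow> bool" where
  "loop_integrable f g \<longleftrightarrow>
     (\<lambda>t. f (pathstart g + of_real t)) integrable_on {0..} \<and>
     f contour_integrable_on g \<and>
     (\<lambda>t. f (pathfinish g + of_real t)) integrable_on {0..}"

definition loop_integral :: "(complex \<Rightarrow> complex) \<Rightarrow> (real \<Rightarrow> complex) \<Rightarrow> complex" where
  "loop_integral f g =
     - integral {0..} (\<lambda>t. f (pathstart g + of_real t)) +
     contour_integral g f +
     integral {0..} (\<lambda>t. f (pathfinish g + of_real t))"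

definition fox_contour ::
  "nat \<Rightarrow> nat \<Rightarrow> (nat \<Rightarrow> complex) \<Rightarrow> (nat \<Rightarrow> real) \<Rightarrow>
   (nat \<Rightarrow> complex) \<Rightarrow> (nat \<Rightarrow> real) \<Rightarrow> (real \<Rightarrow> complex) \<Rightarrow> bool" where
  "fox_contour m n a \<alpha> b \<beta> g \<longleftrightarrow>
     is_right_loop g \<and>
     (\<forall>j\<in>{1..m}. \<forall>l. left_of_loop g (fox_b_pole b \<beta> j l)) \<and>
     (\<forall>i\<in>{1..n}. \<forall>k. right_of_loop g (fox_a_pole a \<alpha> i k))"

text \<open>
  The powers of \<open>z\<close> are taken with respect to an arbitrary value \<open>\<zeta>\<close> of \<open>log z\<close>, so that
  \<open>z\<^sup>w = exp (w * \<zeta>)\<close>.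
\<close>

definition fox_integrand ::
  "nat \<Rightarrow> nat \<Rightarrow> nat \<Rightarrow> nat \<Rightarrow> (nat \<Rightarrow> complex) \<Rightarrow> (nat \<Rightarrow> real) \<Rightarrow>
   (nat \<Rightarrow> complex) \<Rightarrow> (nat \<Rightarrow> real) \<Rightarrow> complex \<Rightarrow> complex \<Rightarrow> complex" where
  "fox_integrand m n p q a \<alpha> b \<beta> \<zeta> s = fox_kernel m n p q a \<alpha> b \<beta> s * exp (- s * \<zeta>)"

definition fox_H ::
  "nat \<Rightarrow> nat \<Rightarrow> nat \<Rightarrow> nat \<Rightarrow> (nat \<Rightarrow> complex) \<Rightarrow> (nat \<Rightarrow> real) \<Rightarrow>
   (nat \<Rightarrow> complex) \<Rightarrow> (nat \<Rightarrow> real) \<Rightarrow> (real \<Rightarrow> complex) \<Rightarrow> complex \<Rightarrow> complex" where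
  "fox_H m n p q a \<alpha> b \<beta> g \<zeta> =
     1 / (2 * of_real pi * \<i>) * loop_integral (fox_integrand m n p q a \<alpha> b \<beta> \<zeta>) g"

text \<open>
  The indices \<open>i\<^sub>1, \<dots>, i\<^sub>N\<close> of the Gamma-functions that have a pole at \<open>c\<close>; each of these poles
  is simple, so the product of these functions has a pole of order \<open>N\<close> at \<open>c\<close>.
\<close>

definition fox_pole_indices :: "nat \<Rightarrow> (nat \<Rightarrow> complex) \<Rightarrow> (nat \<Rightarrow> real) \<Rightarrow> complex \<Rightarrow> nat set" where
  "fox_pole_indices n a \<alpha> c = {r\<in>{1..n}. \<exists>k. c = fox_a_pole a \<alpha> r k}"

definition fox_N :: "nat \<Rightarrow> (nat \<Rightarrow> complex) \<Rightarrow> (nat \<Rightarrow> real) \<Rightarrow> nat \<Rightarrow> nat \<Rightarrow> nat" where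
  "fox_N n a \<alpha> i k = card (fox_pole_indices n a \<alpha> (fox_a_pole a \<alpha> i k))"

definition fox_simple_pairs :: "nat \<Rightarrow> (nat \<Rightarrow> complex) \<Rightarrow> (nat \<Rightarrow> real) \<Rightarrow> (nat \<times> nat) set" where
  "fox_simple_pairs n a \<alpha> = {(i, k). i \<in> {1..n} \<and> fox_N n a \<alpha> i k = 1}"

text \<open>
  A pole of order \<open>N > 1\<close> equals \<open>a\<^sub>i\<^sub>k\<close> for \<open>N\<close> different pairs \<open>(i, k)\<close>. Every pole
  occurs once in the expansion; it is represented by the pair with the least \<open>i\<close>.
\<close>

definition fox_multiple_pairs :: "nat \<Rightarrow> (nat \<Rightarrow> complex) \<Rightarrow> (nat \<Rightarrow> real) \<Rightarrow> (nat \<times> nat) set" where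
  "fox_multiple_pairs n a \<alpha> =
     {(i, k). i \<in> {1..n} \<and> fox_N n a \<alpha> i k > 1 \<and>
              i = Min (fox_pole_indices n a \<alpha> (fox_a_pole a \<alpha> i k))}"

definition fox_h ::
  "nat \<Rightarrow> nat \<Rightarrow> nat \<Rightarrow> nat \<Rightarrow> (nat \<Rightarrow> complex) \<Rightarrow> (nat \<Rightarrow> real) \<Rightarrow>
   (nat \<Rightarrow> complex) \<Rightarrow> (nat \<Rightarrow> real) \<Rightarrow> nat \<Rightarrow> nat \<Rightarrow> complex" where
  "fox_h m n p q a \<alpha> b \<beta> i k =
     (-1) ^ k / (fact k * of_real (\<alpha> i)) *
     ((\<Prod>j=1..m. Gamma (b j + (1 - a i + of_nat k) * of_real (\<beta> j / \<alpha> i))) *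
      (\<Prod>j\<in>{1..n} - {i}. Gamma (1 - a j - (1 - a i + of_nat k) * of_real (\<alpha> j / \<alpha> i)))) /
     ((\<Prod>j=n+1..p. Gamma (a j + (1 - a i + of_nat k) * of_real (\<alpha> j / \<alpha> i))) *
      (\<Prod>j=m+1..q. Gamma (1 - b j - (1 - a i + of_nat k) * of_real (\<beta> j / \<alpha> i))))"

definition fox_H1 ::
  "nat \<Rightarrow> (nat \<Rightarrow> complex) \<Rightarrow> (nat \<Rightarrow> real) \<Rightarrow> complex \<Rightarrow> complex \<Rightarrow> complex" where
  "fox_H1 n a \<alpha> c s =
     (s - c) ^ card (fox_pole_indices n a \<alpha> c) *
     (\<Prod>r\<in>fox_pole_indices n a \<alpha> c. Gamma (1 - a r - of_real (\<alpha> r) * s))"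

definition fox_H2 ::
  "nat \<Rightarrow> nat \<Rightarrow> nat \<Rightarrow> nat \<Rightarrow> (nat \<Rightarrow> complex) \<Rightarrow> (nat \<Rightarrow> real) \<Rightarrow>
   (nat \<Rightarrow> complex) \<Rightarrow> (nat \<Rightarrow> real) \<Rightarrow> complex \<Rightarrow> complex \<Rightarrow> complex" where
  "fox_H2 m n p q a \<alpha> b \<beta> c s =
     fox_kernel m n p q a \<alpha> b \<beta> s /
     (\<Prod>r\<in>fox_pole_indices n a \<alpha> c. Gamma (1 - a r - of_real (\<alpha> r) * s))"

text \<open>
  \<open>remove_sings\<close> extends \<open>H\<^sub>1\<close> and \<open>H\<^sub>2\<close> analytically to the pole. The sum divided by
  \<open>(N - 1)!\<close> is the coefficient of \<open>z\<^sup>-\<^sup>c (log z)\<^sup>j\<close> in the residue at the pole \<open>c\<close>. The loop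
  runs clockwise, so the residue enters with the sign \<open>-1\<close>, which is also the sign contained in
  \<open>fox_h\<close>: for \<open>N = 1\<close> and \<open>j = 0\<close> the formula below gives \<open>fox_h\<close>. (The sign is missing in the
  formula for this coefficient in the literature.)
\<close>

definition fox_Hcoeff ::
  "nat \<Rightarrow> nat \<Rightarrow> nat \<Rightarrow> nat \<Rightarrow> (nat \<Rightarrow> complex) \<Rightarrow> (nat \<Rightarrow> real) \<Rightarrow>
   (nat \<Rightarrow> complex) \<Rightarrow> (nat \<Rightarrow> real) \<Rightarrow> nat \<Rightarrow> nat \<Rightarrow> nat \<Rightarrow> complex" where
  "fox_Hcoeff m n p q a \<alpha> b \<beta> i k j =
     (let c = fox_a_pole a \<alpha> i k; N = fox_N n a \<alpha> i k in
      - (1 / fact (N - 1) *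
         (\<Sum>\<nu>=j..N-1. (-1) ^ j * of_nat ((N - 1) choose \<nu>) * of_nat (\<nu> choose j) *
            (deriv ^^ (N - 1 - \<nu>)) (remove_sings (fox_H1 n a \<alpha> c)) c *
            (deriv ^^ (\<nu> - j)) (remove_sings (fox_H2 m n p q a \<alpha> b \<beta> c)) c)))"

text \<open>
  Poles of different Gamma-functions may come arbitrarily close to each other (for instance if
  \<open>n = 2\<close> and \<open>\<alpha>\<^sub>1 / \<alpha>\<^sub>2\<close> is a Liouville number), and then the individual terms of the expansion
  need not tend to 0. In general the series converges when the poles are taken in the order of
  their real parts and the terms are bracketed at abscissae that keep a fixed distance from the
  poles. If distinct poles keep a fixed distance from each other, it converges unconditionally.
\<close>

definition fox_cutoffs ::
  "nat \<Rightarrow> (nat \<Rightarrow> complex) \<Rightarrow> (nat \<Rightarrow> real) \<Rightarrow> (nat \<Rightarrow> real) \<Rightarrow> bool" where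
  "fox_cutoffs n a \<alpha> X \<longleftrightarrow>
     filterlim X at_top sequentially \<and>
     (\<exists>\<epsilon>>0. \<forall>\<nu>. \<forall>i\<in>{1..n}. \<forall>k. \<epsilon> \<le> \<bar>X \<nu> - Re (fox_a_pole a \<alpha> i k)\<bar>)"

definition fox_poles_separated :: "nat \<Rightarrow> (nat \<Rightarrow> complex) \<Rightarrow> (nat \<Rightarrow> real) \<Rightarrow> bool" where
  "fox_poles_separated n a \<alpha> \<longleftrightarrow>
     (\<exists>\<epsilon>>0. \<forall>i\<in>{1..n}. \<forall>i'\<in>{1..n}. \<forall>k k'. fox_a_pole a \<alpha> i k \<noteq> fox_a_pole a \<alpha> i' k' \<longrightarrow>
        \<epsilon> \<le> dist (fox_a_pole a \<alpha> i k) (fox_a_pole a \<alpha> i' k'))"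

end

theory Submission
  imports Defs "HOL-Real_Asymp.Real_Asymp"
begin

text \<open>
  In a horizontal strip, Stirling's formula and the reflection formula bound the integrand by
  \<open>exp (- \<kappa> * Re s)\<close> for large \<open>Re s\<close>, as long as \<open>s\<close> keeps a fixed distance from the poles
  \<open>a\<^sub>i\<^sub>k\<close>; this is where the conditions on \<open>\<Delta>\<close>, \<open>\<delta>\<close> and \<open>z\<close> enter. Hence the integral over
  the loop converges, and it is the limit of the integrals over the closed loops whose vertical
  sides lie at admissible abscissae. By the residue theorem these are the partial sums of the
  residues, which Leibniz' rule turns into the coefficients of the expansion. If the poles are
  separated, the same bound on small circles around them yields absolute convergence.
\<close>

section \<open>Growth of the Gamma function in horizontal strips\<close>

text \<open>Errors of size exp (o(Re s)) do not matter, so on a strip complex Gamma values are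
  compared with real ones: Gauss' limit formula bounds the quotient both ways, and Stirling's
  formula on the real axis follows from the functional equation. Each factor is then bounded by exp
  (c x ln x + d x + o(x)) with x = Re s. Over all factors, including exp (- s * \<zeta>), the
  coefficients add up to \<Delta> and to ln \<delta> - \<Delta> - ln |z|; this is the origin of the
  two alternative conditions. The obstacle is that infinitely many poles run to the right through
  the strip. The two half-lines keep a distance from them because the poles of one Gamma-function
  share an ordinate, and a half-line at that height would hit a pole. For the vertical sides, the
  distance is gained by a pigeonhole choice of the abscissae. Finally, the winding number around a
  pole is prescribed only beyond an abscissa that depends on the pole; a deformation of the loop
  makes this threshold explicit.\<close>

lemma norm_Gamma_le_Gamma_Re:
  assumes "Re z > 0"
  shows "norm (Gamma z) \<le> Gamma (Re z)"
proof (rule tendsto_le)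
  show "(\<lambda>n. norm (Gamma_series z n)) \<longlonglongrightarrow> norm (Gamma z)"
    by (intro tendsto_intros)
  show "Gamma_series (Re z) \<longlonglongrightarrow> Gamma (Re z)"
    by (intro tendsto_intros)
  show "\<forall>\<^sub>F n in sequentially. norm (Gamma_series z n) \<le> Gamma_series (Re z) n"
    using eventually_gt_at_top[of 0]
  proof eventually_elim
    case (elim n)
    \<comment> \<open>In Gauss' limit the modulus of the numerator depends on Re z only, and every
      factor of the denominator satisfies |z + k| \<ge> Re z + k.\<close>
    have "norm (exp (z * ln (of_nat n))) = exp (Re z * ln (real n))"
      using elim by simp
    moreover have "pochhammer (Re z) (n+1) \<le> norm (pochhammer z (n+1))"
      unfolding pochhammer_prod prod_norm[symmetric]
    proof (rule prod_mono, safe)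
      fix k :: nat
      show "0 \<le> Re z + real k" using assms by simp
      show "Re z + real k \<le> norm (z + of_nat k)"
        using complex_Re_le_cmod[of "z + of_nat k"] by simp
    qed
    moreover have "pochhammer (Re z) (n+1) > 0"
      using assms by (rule pochhammer_pos)
    ultimately show ?case
      unfolding Gamma_series_def norm_divide norm_mult
      by (intro frac_le mult_mono) auto
  qed
qed auto

text \<open>The converse comparison costs sqrt (1 + Y^2 / (Re z + k)^2) for each factor of Gauss'
  product. As Re z + k \<ge> k + 1, the product of these stays below the exponential of Y^2 times
  the sum of 1 / (k+1)^2, and Euler's value of that sum gives the constant.\<close>

lemma norm_rGamma_le_rGamma_Re:
  assumes "Re z \<ge> 1" and "\<bar>Im z\<bar> \<le> Y"
  shows "norm (rGamma z) \<le> exp (Y^2 * (pi^2 / 6)) * rGamma (Re z)"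
proof (rule tendsto_le)
  show "(\<lambda>n. norm (rGamma_series z n)) \<longlonglongrightarrow> norm (rGamma z)"
    by (intro tendsto_intros)
  show "(\<lambda>n. exp (Y^2 * (pi^2 / 6)) * rGamma_series (Re z) n)
          \<longlonglongrightarrow> exp (Y^2 * (pi^2 / 6)) * rGamma (Re z)"
    by (intro tendsto_intros)
  show "\<forall>\<^sub>F n in sequentially. norm (rGamma_series z n) \<le> exp (Y^2 * (pi^2 / 6)) * rGamma_series (Re z) n"
    using eventually_gt_at_top[of 0]
  proof eventually_elim
    case (elim n)
    have E: "norm (exp (z * ln (of_nat n))) = exp (Re z * ln (real n))"
      using elim by simp
    have "norm (pochhammer z (n+1)) \<le> (\<Prod>k<n+1. (Re z + real k) * exp (Y^2 / real (k+1)^2))"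
      unfolding pochhammer_prod prod_norm[symmetric] lessThan_atLeast0
    proof (rule prod_mono, safe)
      fix k :: nat
      show "0 \<le> norm (z + of_nat k)" by simp
      have k: "0 < real (k+1)" "real (k+1) \<le> Re z + real k" using assms by auto
      have "(norm (z + of_nat k))^2 = (Re z + real k)^2 + (Im z)^2"
        by (simp add: cmod_power2)
      also have "\<dots> \<le> (Re z + real k)^2 + Y^2"
        using power_mono[OF assms(2), of 2] by simp
      also have "Y^2 = real (k+1)^2 * (Y^2 / real (k+1)^2)"
        by simp
      also have "(Re z + real k)^2 + real (k+1)^2 * (Y^2 / real (k+1)^2)
                   \<le> (Re z + real k)^2 + (Re z + real k)^2 * (Y^2 / real (k+1)^2)"
        using k by (intro add_left_mono mult_right_mono power_mono) auto
      also have "(Re z + real k)^2 + (Re z + real k)^2 * (Y^2 / real (k+1)^2)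
                   = (Re z + real k)^2 * (1 + Y^2 / real (k+1)^2)"
        by (simp add: algebra_simps)
      \<comment> \<open>The doubled exponent makes the right-hand side a perfect square, so that the
        root can be taken.\<close>
      also have "\<dots> \<le> (Re z + real k)^2 * exp (2 * (Y^2 / real (k+1)^2))"
      proof (intro mult_left_mono)
        have "0 \<le> Y^2 / real (k+1)^2" by simp
        then show "1 + Y^2 / real (k+1)^2 \<le> exp (2 * (Y^2 / real (k+1)^2))"
          using exp_ge_add_one_self[of "2 * (Y^2 / real (k+1)^2)"] by linarith
      qed auto
      also have "\<dots> = ((Re z + real k) * exp (Y^2 / real (k+1)^2))^2"
        by (simp add: power_mult_distrib power2_eq_square flip: exp_add)
      finally show "norm (z + of_nat k) \<le> (Re z + real k) * exp (Y^2 / real (k+1)^2)"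
        using k by (elim power2_le_imp_le) auto
    qed
    also have "\<dots> = pochhammer (Re z) (n+1) * exp (Y^2 * (\<Sum>k<n+1. 1 / real (k+1)^2))"
      by (simp only: prod.distrib pochhammer_prod lessThan_atLeast0 sum_distrib_left
            exp_sum[OF finite_atLeastLessThan] times_divide_eq_right mult_1_right)
    also have "\<dots> \<le> pochhammer (Re z) (n+1) * exp (Y^2 * (pi^2 / 6))"
    proof (intro mult_left_mono)
      have "(\<Sum>k<n+1. 1 / real (k+1)^2) \<le> pi^2 / 6"
        using sum_le_suminf[OF sums_summable[OF inverse_squares_sums], of "{..<n+1}"]
              sums_unique[OF inverse_squares_sums] by simp
      then show "exp (Y^2 * (\<Sum>k<n+1. 1 / real (k+1)^2)) \<le> exp (Y^2 * (pi^2 / 6))"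
        by (subst exp_le_cancel_iff, intro mult_left_mono) auto
      show "0 \<le> pochhammer (Re z) (n+1)"
        using assms pochhammer_pos[of "Re z" "n+1"] by simp
    qed
    finally have "norm (pochhammer z (n+1)) / (fact n * exp (Re z * ln (real n)))
        \<le> pochhammer (Re z) (n+1) * exp (Y^2 * (pi^2 / 6)) / (fact n * exp (Re z * ln (real n)))"
      by (intro divide_right_mono) auto
    then show ?case
      unfolding rGamma_series_def norm_divide norm_mult E by (simp add: mult_ac)
  qed
qed auto

text \<open>By the functional equation ln (Gamma x) grows like a sum of values of ln, hence like the
  primitive x ln x - x. Along unit steps \<open>u\<close> decreases and \<open>v\<close> increases,
  so bounds for them on the compact interval [1, 2] give \<open>C\<close>. The two estimates are
  O(ln x) apart, which is precise enough.\<close>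

lemma ln_Gamma_real_bounds:
  obtains C :: real where
    "\<And>x. x \<ge> 2 \<Longrightarrow> ln (Gamma x) \<le> x * ln x - x + C"
    "\<And>x. x \<ge> 2 \<Longrightarrow> ln (Gamma x) \<ge> (x - 1) * ln (x - 1) - (x - 1) - C"
proof -
  define G where "G = (\<lambda>x::real. x * ln x - x)"
  \<comment> \<open>The mean of ln over [y, y+1] lies between its end values; both halves follow
    from ln t \<le> t - 1.\<close>
  have G1: "ln y \<le> G (y+1) - G y" and G2: "G (y+1) - G y \<le> ln (y+1)" if "y > 0" for y
  proof -
    have "ln (y / (y+1)) \<le> y / (y+1) - 1" using that by (intro ln_le_minus_one) auto
    also have "\<dots> = - 1 / (y+1)" using that by (simp add: field_simps)
    finally have "ln y - ln (y+1) \<le> - 1 / (y+1)" using that by (simp add: ln_div)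
    then have "(y+1) * (ln y - ln (y+1)) \<le> -1" using that by (simp add: field_simps)
    then show "ln y \<le> G (y+1) - G y" by (simp add: G_def algebra_simps)
    have "ln ((y+1) / y) \<le> (y+1) / y - 1" using that by (intro ln_le_minus_one) auto
    also have "\<dots> = 1 / y" using that by (simp add: field_simps)
    finally have "ln (y+1) - ln y \<le> 1 / y" using that by (simp add: ln_div)
    then have "y * (ln (y+1) - ln y) \<le> 1" using that by (simp add: field_simps)
    then show "G (y+1) - G y \<le> ln (y+1)" by (simp add: G_def algebra_simps)
  qed
  define u where "u = (\<lambda>y. ln (Gamma y) - G y)"
  define v where "v = (\<lambda>y. ln (Gamma (y+1)) - G y)"
  have step: "ln (Gamma (y+1)) = ln y + ln (Gamma y)" if "y > 0" for y :: real
  proof -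
    have "y \<notin> \<int>\<^sub>\<le>\<^sub>0" using that by (auto elim: nonpos_Ints_cases)
    moreover have "Gamma y \<noteq> 0" using Gamma_real_pos[OF that] by linarith
    ultimately show ?thesis using that by (simp add: Gamma_plus1 ln_mult)
  qed
  have u: "u (y + real n) \<le> u y" if "y > 0" for y n
  proof (induction n)
    case (Suc n)
    have "u (y + real n + 1) \<le> u (y + real n)"
      using step[of "y + real n"] G1[of "y + real n"] that by (simp add: u_def)
    with Suc show ?case by (simp add: add_ac)
  qed simp
  have v: "v y \<le> v (y + real n)" if "y > 0" for y n
  proof (induction n)
    case (Suc n)
    have "v (y + real n) \<le> v (y + real n + 1)"
      using step[of "y + real n + 1"] G2[of "y + real n"] that by (simp add: v_def)
    with Suc show ?case by (simp add: add_ac)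
  qed simp
  have no: "{1..2::real} \<inter> \<int>\<^sub>\<le>\<^sub>0 = {}" "(\<lambda>x. x + 1) ` {1..2} \<inter> \<int>\<^sub>\<le>\<^sub>0 = ({} :: real set)"
    by (auto elim!: nonpos_Ints_cases)
  have cu: "continuous_on {1..2} u" unfolding u_def G_def
    using no by (intro continuous_intros continuous_on_Gamma) (auto simp: Gamma_eq_zero_iff)
  have "continuous_on {1..2} (\<lambda>y::real. Gamma (y+1))"
    by (rule continuous_on_compose2[OF continuous_on_Gamma[OF no(2)]]) (auto intro!: continuous_intros)
  moreover have "Gamma (y+1) \<noteq> 0" if "y \<in> {1..2}" for y :: real
    using that by (intro less_imp_neq[THEN not_sym] Gamma_real_pos) auto
  ultimately have cv: "continuous_on {1..2} v" unfolding v_def G_def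
    by (intro continuous_intros) auto
  obtain B1 where B1: "\<And>y. y \<in> {1..2} \<Longrightarrow> \<bar>u y\<bar> \<le> B1"
    using compact_imp_bounded[OF compact_continuous_image[OF cu]] unfolding bounded_iff by fastforce
  obtain B2 where B2: "\<And>y. y \<in> {1..2} \<Longrightarrow> \<bar>v y\<bar> \<le> B2"
    using compact_imp_bounded[OF compact_continuous_image[OF cv]] unfolding bounded_iff by fastforce
  have red: "\<exists>y n. y \<in> {1..2} \<and> x = y + real n" if "x \<ge> 1" for x :: real
  proof (intro exI conjI)
    show "x = (x - real (nat \<lfloor>x - 1\<rfloor>)) + real (nat \<lfloor>x - 1\<rfloor>)" by simp
    show "x - real (nat \<lfloor>x - 1\<rfloor>) \<in> {1..2}"
      using that floor_correct[of "x - 1"] by (simp add: of_nat_nat, linarith)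
  qed
  show thesis
  proof (rule that[of "\<bar>B1\<bar> + \<bar>B2\<bar>"])
    fix x :: real assume x: "x \<ge> 2"
    from red[of x] x obtain y n where y: "y \<in> {1..2}" "x = y + real n" by auto
    have "u x \<le> u y" using u[of y n] y by simp
    also have "\<dots> \<le> \<bar>B1\<bar> + \<bar>B2\<bar>" using B1[OF y(1)] by linarith
    finally show "ln (Gamma x) \<le> x * ln x - x + (\<bar>B1\<bar> + \<bar>B2\<bar>)" by (simp add: u_def G_def)
    \<comment> \<open>The lower bound is read off at x - 1, which must be at least 1 to be reduced
      to [1, 2]; hence the condition x \<ge> 2.\<close>
    from red[of "x - 1"] x obtain y n where y: "y \<in> {1..2}" "x - 1 = y + real n" by auto
    have "v y \<le> v (x - 1)" using v[of y n] y by simp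
    moreover have "- (\<bar>B1\<bar> + \<bar>B2\<bar>) \<le> v y" using B2[OF y(1)] by linarith
    ultimately show "ln (Gamma x) \<ge> (x - 1) * ln (x - 1) - (x - 1) - (\<bar>B1\<bar> + \<bar>B2\<bar>)"
      by (simp add: v_def G_def)
  qed
qed

text \<open>When both Stirling bounds are expanded at b + c * x, the shift b and the gap between the
  bounds contribute only O(ln x), which disappears after division by x.\<close>

lemma tendsto_ln_Gamma_affine:
  fixes b c :: real
  assumes "c > 0"
  shows "((\<lambda>x. (ln (Gamma (b + c * x)) - (c * (x * ln x) + (c * ln c - c) * x)) / x) \<longlongrightarrow> 0) at_top"
proof -
  obtain C :: real where C: "\<And>x. x \<ge> 2 \<Longrightarrow> ln (Gamma x) \<le> x * ln x - x + C"
    "\<And>x. x \<ge> 2 \<Longrightarrow> ln (Gamma x) \<ge> (x - 1) * ln (x - 1) - (x - 1) - C"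
    using ln_Gamma_real_bounds by blast
  have l: "\<forall>\<^sub>F x in at_top. b + c * x \<ge> 2" "\<forall>\<^sub>F x in at_top. x > (0::real)"
    using assms by real_asymp+
  show ?thesis
  proof (rule tendsto_sandwich)
    show "\<forall>\<^sub>F x in at_top. ((b + c * x - 1) * ln (b + c * x - 1) - (b + c * x - 1) - C -
          (c * (x * ln x) + (c * ln c - c) * x)) / x \<le>
          (ln (Gamma (b + c * x)) - (c * (x * ln x) + (c * ln c - c) * x)) / x"
      using l by eventually_elim (intro divide_right_mono diff_right_mono C(2), auto)
    show "\<forall>\<^sub>F x in at_top. (ln (Gamma (b + c * x)) - (c * (x * ln x) + (c * ln c - c) * x)) / x
        \<le> ((b + c * x) * ln (b + c * x) - (b + c * x) + C - (c * (x * ln x) + (c * ln c - c) * x)) / x"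
      using l by eventually_elim (intro divide_right_mono diff_right_mono C(1), auto)
    show "((\<lambda>x. ((b + c * x - 1) * ln (b + c * x - 1) - (b + c * x - 1) - C -
          (c * (x * ln x) + (c * ln c - c) * x)) / x) \<longlongrightarrow> 0) at_top"
      using assms by real_asymp
    show "((\<lambda>x. ((b + c * x) * ln (b + c * x) - (b + c * x) + C -
          (c * (x * ln x) + (c * ln c - c) * x)) / x) \<longlongrightarrow> 0) at_top"
      using assms by real_asymp
  qed
qed

lemma eventually_ln_Gamma_affine:
  fixes b c \<eta> :: real
  assumes "c > 0" "\<eta> > 0"
  shows "\<forall>\<^sub>F x in at_top. \<bar>ln (Gamma (b + c * x)) - (c * (x * ln x) + (c * ln c - c) * x)\<bar> < \<eta> * x"
  using tendstoD[OF tendsto_ln_Gamma_affine[OF assms(1)] assms(2)] eventually_gt_at_top[of 0]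
  by eventually_elim (simp add: dist_real_def pos_divide_less_eq)

text \<open>
  The rate \<open>exp (c x ln x + d x)\<close> with \<open>x = Re s\<close> is prescribed up to a factor \<open>exp (o(x))\<close>, so
  that polynomial factors are invisible and rates simply add up over products.
\<close>

definition growth :: "complex filter \<Rightarrow> (complex \<Rightarrow> complex) \<Rightarrow> real \<Rightarrow> real \<Rightarrow> bool" where
  "growth F f c d \<longleftrightarrow>
     (\<forall>\<eta>>0. \<forall>\<^sub>F s in F. norm (f s) \<le> exp (c * (Re s * ln (Re s)) + (d + \<eta>) * Re s))"

lemma growthD:
  "growth F f c d \<Longrightarrow> \<eta> > 0 \<Longrightarrow>
     \<forall>\<^sub>F s in F. norm (f s) \<le> exp (c * (Re s * ln (Re s)) + (d + \<eta>) * Re s)"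
  by (simp add: growth_def)

lemma growth_cong:
  assumes "\<forall>\<^sub>F s in F. f s = g s"
  shows "growth F f c d \<longleftrightarrow> growth F g c d"
proof -
  have "growth F f c d" if "growth F g c d" and "\<forall>\<^sub>F s in F. f s = g s" for f g
    unfolding growth_def
  proof (intro allI impI)
    fix \<eta> :: real assume "\<eta> > 0"
    from growthD[OF that(1) this] that(2)
    show "\<forall>\<^sub>F s in F. norm (f s) \<le> exp (c * (Re s * ln (Re s)) + (d + \<eta>) * Re s)"
      by eventually_elim simp
  qed
  from this[of f g] this[of g f] assms show ?thesis
    by (auto simp: eq_commute)
qed

lemma growth_mult:
  assumes "growth F f c d" "growth F g c' d'"
  shows "growth F (\<lambda>s. f s * g s) (c + c') (d + d')"
  unfolding growth_def
proof (intro allI impI)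
  fix \<eta> :: real assume "\<eta> > 0"
  then have "\<eta> / 2 > 0" by simp
  from growthD[OF assms(1) this] growthD[OF assms(2) this]
  show "\<forall>\<^sub>F s in F. norm (f s * g s) \<le> exp ((c + c') * (Re s * ln (Re s)) + (d + d' + \<eta>) * Re s)"
  proof eventually_elim
    case (elim s)
    have "norm (f s * g s) \<le> exp (c * (Re s * ln (Re s)) + (d + \<eta>/2) * Re s) *
                              exp (c' * (Re s * ln (Re s)) + (d' + \<eta>/2) * Re s)"
      unfolding norm_mult using elim by (intro mult_mono) auto
    also have "\<dots> = exp ((c + c') * (Re s * ln (Re s)) + (d + d' + \<eta>) * Re s)"
      by (simp add: algebra_simps flip: exp_add)
    finally show ?case .
  qed
qed

text \<open>The phrase "for large Re s, uniformly over the admissible points of a strip" becomes one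
  abstract filter, so that estimates combine by \<open>eventually_elim\<close>. The actual filter is
  supplied in \<open>decay\<close>.\<close>

locale right_filter =
  fixes F :: "complex filter" and Y :: real
  assumes Re_at_top: "filterlim Re at_top F"
    and Im_bounded: "\<forall>\<^sub>F s in F. \<bar>Im s\<bar> \<le> Y"
begin

lemma eventually_Re: "eventually P at_top \<Longrightarrow> \<forall>\<^sub>F s in F. P (Re s)"
  using Re_at_top by (rule eventually_compose_filterlim[rotated])

text \<open>Constants vanish in the slack: B \<le> \<eta> * Re s \<le> exp (\<eta> * Re s) once Re s
  is large. This absorbs the trigonometric factors of the reflection formulas.\<close>

lemma growth_bounded:
  assumes "\<forall>\<^sub>F s in F. norm (f s) \<le> B"
  shows "growth F f 0 0"
  unfolding growth_def
proof (intro allI impI)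
  fix \<eta> :: real assume \<eta>: "\<eta> > 0"
  from assms eventually_Re[OF eventually_ge_at_top[of "B / \<eta>"]]
  show "\<forall>\<^sub>F s in F. norm (f s) \<le> exp (0 * (Re s * ln (Re s)) + (0 + \<eta>) * Re s)"
  proof eventually_elim
    case (elim s)
    have "B \<le> \<eta> * Re s" using elim \<eta> by (simp add: field_simps)
    also have "\<dots> \<le> exp (\<eta> * Re s)" using exp_ge_add_one_self[of "\<eta> * Re s"] by linarith
    finally show ?case using elim by simp
  qed
qed

lemma growth_prod:
  assumes "finite I" "\<And>i. i \<in> I \<Longrightarrow> growth F (f i) (c i) (d i)"
  shows "growth F (\<lambda>s. \<Prod>i\<in>I. f i s) (\<Sum>i\<in>I. c i) (\<Sum>i\<in>I. d i)"
  using assms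
proof (induction I)
  case empty
  show ?case using growth_bounded[of "\<lambda>_. 1" 1] by simp
next
  case (insert i I)
  then show ?case using growth_mult[of F "f i"] by simp
qed

lemma growth_Gamma:
  assumes "c > 0"
  shows "growth F (\<lambda>s. Gamma (b + of_real c * s)) c (c * ln c - c)"
  unfolding growth_def
proof (intro allI impI)
  fix \<eta> :: real assume \<eta>: "\<eta> > 0"
  have "\<forall>\<^sub>F x in at_top. Re b + c * x > 0" using assms by real_asymp
  from eventually_Re[OF this] eventually_Re[OF eventually_gt_at_top[of 0]]
    eventually_Re[OF eventually_ln_Gamma_affine[OF assms \<eta>, of "Re b"]]
  show "\<forall>\<^sub>F s in F. norm (Gamma (b + of_real c * s)) \<le>
          exp (c * (Re s * ln (Re s)) + (c * ln c - c + \<eta>) * Re s)"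
  proof eventually_elim
    case (elim s)
    have "norm (Gamma (b + of_real c * s)) \<le> Gamma (Re b + c * Re s)"
      using norm_Gamma_le_Gamma_Re[of "b + of_real c * s"] elim by simp
    also have "\<dots> = exp (ln (Gamma (Re b + c * Re s)))" using elim by simp
    also have "\<dots> \<le> exp (c * (Re s * ln (Re s)) + (c * ln c - c + \<eta>) * Re s)"
    proof (rule iffD2[OF exp_le_cancel_iff])
      have "ln (Gamma (Re b + c * Re s)) - (c * (Re s * ln (Re s)) + (c * ln c - c) * Re s) \<le> \<eta> * Re s"
        using elim by linarith
      then show "ln (Gamma (Re b + c * Re s)) \<le> c * (Re s * ln (Re s)) + (c * ln c - c + \<eta>) * Re s"
        by (simp add: algebra_simps)
    qed
    finally show ?case .
  qed
qed

lemma growth_rGamma: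
  assumes "c > 0"
  shows "growth F (\<lambda>s. rGamma (a + of_real c * s)) (-c) (c - c * ln c)"
  unfolding growth_def
proof (intro allI impI)
  fix \<eta> :: real assume "\<eta> > 0"
  then have \<eta>: "\<eta> / 2 > 0" by simp
  \<comment> \<open>\<open>K\<close> is the price for passing from the complex to the real
    reciprocal Gamma function. Half of \<eta> pays for it, the other half for the error in
    Stirling's formula.\<close>
  define K where "K = exp ((\<bar>Im a\<bar> + c * Y)^2 * (pi^2 / 6))"
  have "\<forall>\<^sub>F x in at_top. Re a + c * x \<ge> 1" using assms by real_asymp
  from eventually_Re[OF this] eventually_Re[OF eventually_gt_at_top[of 0]] Im_bounded
    eventually_Re[OF eventually_ge_at_top[of "K / (\<eta> / 2)"]]
    eventually_Re[OF eventually_ln_Gamma_affine[OF assms \<eta>, of "Re a"]]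
  show "\<forall>\<^sub>F s in F. norm (rGamma (a + of_real c * s)) \<le>
          exp (- c * (Re s * ln (Re s)) + (c - c * ln c + \<eta>) * Re s)"
  proof eventually_elim
    case (elim s)
    have pos: "Gamma (Re a + c * Re s) > 0" using elim by (intro Gamma_real_pos) auto
    have "\<bar>Im (a + of_real c * s)\<bar> \<le> \<bar>Im a\<bar> + c * \<bar>Im s\<bar>"
      using abs_triangle_ineq[of "Im a" "c * Im s"] assms by (simp add: abs_mult)
    also have "\<dots> \<le> \<bar>Im a\<bar> + c * Y" using elim assms by (intro add_left_mono mult_left_mono) auto
    finally have "norm (rGamma (a + of_real c * s)) \<le> K * rGamma (Re a + c * Re s)"
      using norm_rGamma_le_rGamma_Re[of "a + of_real c * s"] elim unfolding K_def by simp
    also have "rGamma (Re a + c * Re s) = exp (- ln (Gamma (Re a + c * Re s)))"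
      using pos by (simp add: rGamma_inverse_Gamma exp_minus)
    also have "K * \<dots> \<le> exp (\<eta>/2 * Re s) *
        exp (- c * (Re s * ln (Re s)) + (c - c * ln c + \<eta>/2) * Re s)"
    proof (intro mult_mono)
      have "K \<le> \<eta>/2 * Re s" using elim \<eta> by (simp add: field_simps)
      also have "\<dots> \<le> exp (\<eta>/2 * Re s)" using exp_ge_add_one_self[of "\<eta>/2 * Re s"] by linarith
      finally show "K \<le> exp (\<eta>/2 * Re s)" .
      have "- (\<eta>/2 * Re s) \<le> ln (Gamma (Re a + c * Re s)) - (c * (Re s * ln (Re s)) + (c * ln c - c) * Re s)"
        using elim by linarith
      then show "exp (- ln (Gamma (Re a + c * Re s))) \<le> exp (- c * (Re s * ln (Re s)) + (c - c * ln c + \<eta>/2) * Re s)"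
        by (simp add: algebra_simps)
    qed auto
    also have "\<dots> = exp (- c * (Re s * ln (Re s)) + (c - c * ln c + \<eta>) * Re s)"
      by (simp add: algebra_simps flip: exp_add)
    finally show ?case .
  qed
qed

end

section \<open>The reflection formula on a strip\<close>

lemma norm_sin_pi_le:
  fixes w :: complex
  shows "norm (sin (of_real pi * w)) \<le> exp (pi * \<bar>Im w\<bar>)"
proof -
  have "norm (sin (of_real pi * w)) \<le>
     (norm (exp (\<i> * (of_real pi * w))) + norm (exp (- (\<i> * (of_real pi * w))))) / 2"
    unfolding sin_exp_eq norm_divide
    by (intro divide_mono order.trans[OF norm_triangle_ineq4]) (auto simp: norm_mult)
  also have "norm (exp (\<i> * (of_real pi * w))) \<le> exp (pi * \<bar>Im w\<bar>)"
    using mult_left_mono[OF abs_ge_minus_self[of "Im w"], of pi] by simp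
  also have "norm (exp (- (\<i> * (of_real pi * w)))) \<le> exp (pi * \<bar>Im w\<bar>)"
    using mult_left_mono[OF abs_ge_minus_self[of "Im w"], of pi] by simp
  finally show ?thesis by simp
qed

text \<open>|sin (pi * w)| has period 1, so w may be moved to 0 \<le> Re w \<le> 1. There the only
  zeros are 0 and 1, and removing balls of radius \<epsilon> around them leaves a compact
  set.\<close>

lemma inverse_sin_pi_bounded:
  assumes "\<epsilon> > 0"
  obtains C :: real where "\<And>w. \<bar>Im w\<bar> \<le> Y \<Longrightarrow> (\<And>n::int. \<epsilon> \<le> dist w (of_int n)) \<Longrightarrow>
     norm (1 / sin (of_real pi * w)) \<le> C"
proof -
  define K where "K = cbox (Complex 0 (-Y)) (Complex 1 Y) \<inter> {w. \<epsilon> \<le> dist w 0} \<inter> {w. \<epsilon> \<le> dist w 1}"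
  have "compact K" unfolding K_def
    by (intro compact_Int_closed compact_cbox closed_Collect_le continuous_intros)
  moreover have nz: "sin (of_real pi * w) \<noteq> 0" if "w \<in> K" for w
  proof
    assume "sin (of_real pi * w) = 0"
    then obtain n :: int where "of_real pi * w = of_real (of_int n * pi)"
      by (auto simp: Complex_Transcendental.sin_eq_0)
    then have w: "w = of_int n" by (simp add: mult.commute)
    with that have "0 \<le> n" "n \<le> 1" unfolding K_def by (auto simp: in_cbox_complex_iff)
    then have "n = 0 \<or> n = 1" by auto
    with that w assms show False by (auto simp: K_def)
  qed
  ultimately have "bounded ((\<lambda>w. 1 / sin (of_real pi * w)) ` K)"
    by (intro compact_imp_bounded compact_continuous_image continuous_intros) auto
  then obtain C where C: "\<And>w. w \<in> K \<Longrightarrow> norm (1 / sin (of_real pi * w)) \<le> C"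
    unfolding bounded_iff by (metis image_eqI)
  show thesis
  proof (rule that[of C])
    fix w :: complex
    assume Y: "\<bar>Im w\<bar> \<le> Y" and d: "\<And>n::int. \<epsilon> \<le> dist w (of_int n)"
    define n where "n = \<lfloor>Re w\<rfloor>"
    have "w - of_int n \<in> K"
      using Y d[of n] d[of "n + 1"] floor_correct[of "Re w"]
      by (auto simp: K_def in_cbox_complex_iff n_def dist_norm algebra_simps abs_le_iff)
    from C[OF this] have "norm (1 / sin (of_real pi * (w - of_int n))) \<le> C" .
    moreover have "norm (sin (of_real pi * (w - of_int n))) = norm (sin (of_real pi * w))"
    proof -
      have "of_real pi * (w - of_int n) = of_real pi * w - of_real (of_int n * pi)"
        by (simp add: algebra_simps)
      moreover have "sin (complex_of_real (of_int n * pi)) = 0"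
        by (subst Complex_Transcendental.sin_eq_0) auto
      moreover have "norm (cos (complex_of_real (of_int n * pi))) = 1"
        by (simp only: norm_of_real cos_of_real) (simp add: mult.commute[of _ pi])
      ultimately show ?thesis by (simp add: sin_diff norm_mult)
    qed
    ultimately show "norm (1 / sin (of_real pi * w)) \<le> C" by (simp add: norm_divide)
  qed
qed

context right_filter
begin

lemma Im_affine_bounded:
  assumes "c > 0"
  shows "\<forall>\<^sub>F s in F. \<bar>Im (a + of_real c * s)\<bar> \<le> \<bar>Im a\<bar> + c * Y"
  using Im_bounded
proof eventually_elim
  case (elim s)
  have "\<bar>Im (a + of_real c * s)\<bar> \<le> \<bar>Im a\<bar> + c * \<bar>Im s\<bar>"
    using abs_triangle_ineq[of "Im a" "c * Im s"] assms by (simp add: abs_mult)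
  also have "\<dots> \<le> \<bar>Im a\<bar> + c * Y" using elim assms by (intro add_left_mono mult_left_mono) auto
  finally show ?case .
qed

text \<open>By reflection the factor equals pi / (sin (pi * (a + c * s)) * Gamma (a + c * s)). The
  reciprocal Gamma function carries the rate, and the sine is bounded away from 0 because its zeros
  on the right correspond to the poles.\<close>

lemma growth_Gamma_reflected:
  assumes "c > 0" "\<epsilon> > 0"
    and far: "\<forall>\<^sub>F s in F. \<forall>k. \<epsilon> \<le> dist s ((1 - a + of_nat k) / of_real c)"
  shows "growth F (\<lambda>s. Gamma (1 - a - of_real c * s)) (-c) (c - c * ln c)"
proof -
  \<comment> \<open>The map from s to a + c * s stretches distances by c and sends pole number k to
    the integer k + 1. The bound 1 takes care of the integers \<le> 0, since Re (a + c * s) \<ge> 1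
    eventually.\<close>
  define e where "e = min 1 (c * \<epsilon>)"
  have "e > 0" using assms by (simp add: e_def)
  from inverse_sin_pi_bounded[OF this, of "\<bar>Im a\<bar> + c * Y"] obtain C where
    C: "\<And>w. \<bar>Im w\<bar> \<le> \<bar>Im a\<bar> + c * Y \<Longrightarrow> (\<And>n::int. e \<le> dist w (of_int n)) \<Longrightarrow>
          norm (1 / sin (of_real pi * w)) \<le> C" by blast
  have Re1: "\<forall>\<^sub>F x in at_top. Re a + c * x \<ge> 1" using assms by real_asymp
  have "\<forall>\<^sub>F s in F. norm (of_real pi * (1 / sin (of_real pi * (a + of_real c * s)))) \<le> pi * C"
    using far eventually_Re[OF Re1] Im_affine_bounded[OF assms(1), of a]
  proof eventually_elim
    case (elim s)
    have "e \<le> dist (a + of_real c * s) (of_int n)" for n :: int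
    proof (cases "n \<ge> 1")
      case True
      define k where "k = nat (n - 1)"
      have n: "of_int n = 1 + complex_of_nat k" using True
        by (simp add: k_def)
      have "a + of_real c * s - of_int n = of_real c * (s - (1 - a + of_nat k) / of_real c)"
        unfolding n using assms(1) by (simp add: field_simps)
      then have "dist (a + of_real c * s) (of_int n) = c * dist s ((1 - a + of_nat k) / of_real c)"
        using assms(1) unfolding dist_norm by (simp add: norm_mult)
      also have "\<dots> \<ge> c * \<epsilon>" using elim assms by simp
      finally show ?thesis by (simp add: e_def)
    next
      case False
      then have "real_of_int n \<le> 0" by simp
      then have "1 \<le> Re (a + of_real c * s - of_int n)" using elim by simp
      also have "\<dots> \<le> dist (a + of_real c * s) (of_int n)"
        unfolding dist_norm by (rule complex_Re_le_cmod)
      finally show ?thesis by (simp add: e_def)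
    qed
    then have "norm (1 / sin (of_real pi * (a + of_real c * s))) \<le> C"
      using elim by (intro C) auto
    from mult_left_mono[OF this, of pi] show ?case
      unfolding norm_mult by simp
  qed
  from growth_mult[OF growth_bounded[OF this] growth_rGamma[OF assms(1), of a]]
  have g: "growth F (\<lambda>s. of_real pi * (1 / sin (of_real pi * (a + of_real c * s))) *
           rGamma (a + of_real c * s)) (-c) (c - c * ln c)" by simp
  have "\<forall>\<^sub>F s in F. Gamma (1 - a - of_real c * s) =
      of_real pi * (1 / sin (of_real pi * (a + of_real c * s))) * rGamma (a + of_real c * s)"
    using eventually_Re[OF Re1]
  proof eventually_elim
    case (elim s)
    have "a + of_real c * s \<notin> \<int>\<^sub>\<le>\<^sub>0"
    proof
      assume "a + of_real c * s \<in> \<int>\<^sub>\<le>\<^sub>0"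
      then obtain n :: int where n: "a + of_real c * s = of_int n" "n \<le> 0"
        by (auto elim: nonpos_Ints_cases)
      from arg_cong[OF n(1), of Re] n(2) elim show False by simp
    qed
    then have "Gamma (a + of_real c * s) \<noteq> 0" by (simp add: Gamma_eq_zero_iff)
    then have "Gamma (1 - a - of_real c * s) =
        Gamma (a + of_real c * s) * Gamma (1 - (a + of_real c * s)) * rGamma (a + of_real c * s)"
      by (simp add: rGamma_inverse_Gamma diff_diff_eq)
    also have "Gamma (a + of_real c * s) * Gamma (1 - (a + of_real c * s)) =
        of_real pi / sin (of_real pi * (a + of_real c * s))"
      by (rule Gamma_reflection_complex)
    finally show ?case by (simp only: times_divide_eq_right mult_1_right)
  qed
  from growth_cong[OF this] g show ?thesis by (rule iffD2)
qed

text \<open>Here reflection puts the sine into the numerator, where it is bounded on a strip, so the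
  rate is that of Gamma (b + c * s).\<close>

lemma growth_rGamma_reflected:
  assumes "c > 0"
  shows "growth F (\<lambda>s. rGamma (1 - b - of_real c * s)) c (c * ln c - c)"
proof -
  have "\<forall>\<^sub>F s in F. norm (sin (of_real pi * (b + of_real c * s)) / of_real pi) \<le>
          exp (pi * (\<bar>Im b\<bar> + c * Y)) / pi"
    using Im_affine_bounded[OF assms, of b]
  proof eventually_elim
    case (elim s)
    have "norm (sin (of_real pi * (b + of_real c * s))) \<le> exp (pi * \<bar>Im (b + of_real c * s)\<bar>)"
      by (rule norm_sin_pi_le)
    also have "\<dots> \<le> exp (pi * (\<bar>Im b\<bar> + c * Y))" using elim by simp
    finally show ?case by (simp add: norm_divide divide_right_mono)
  qed
  from growth_mult[OF growth_bounded[OF this] growth_Gamma[OF assms, of b]]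
  have g: "growth F (\<lambda>s. sin (of_real pi * (b + of_real c * s)) / of_real pi *
          Gamma (b + of_real c * s)) c (c * ln c - c)" by simp
  have "\<forall>\<^sub>F x in at_top. Re b + c * x \<ge> 1" using assms by real_asymp
  from eventually_Re[OF this]
  have "\<forall>\<^sub>F s in F. rGamma (1 - b - of_real c * s) =
      sin (of_real pi * (b + of_real c * s)) / of_real pi * Gamma (b + of_real c * s)"
  proof eventually_elim
    case (elim s)
    have "b + of_real c * s \<notin> \<int>\<^sub>\<le>\<^sub>0"
    proof
      assume "b + of_real c * s \<in> \<int>\<^sub>\<le>\<^sub>0"
      then obtain n :: int where n: "b + of_real c * s = of_int n" "n \<le> 0"
        by (auto elim: nonpos_Ints_cases)
      from arg_cong[OF n(1), of Re] n(2) elim show False by simp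
    qed
    then have "rGamma (b + of_real c * s) \<noteq> 0" by (simp add: rGamma_eq_zero_iff)
    then have "rGamma (1 - b - of_real c * s) =
        rGamma (b + of_real c * s) * rGamma (1 - (b + of_real c * s)) * Gamma (b + of_real c * s)"
      by (simp add: Gamma_def diff_diff_eq)
    also have "rGamma (b + of_real c * s) * rGamma (1 - (b + of_real c * s)) =
        sin (of_real pi * (b + of_real c * s)) / of_real pi"
      by (rule rGamma_reflection_complex)
    finally show ?case .
  qed
  from growth_cong[OF this] g show ?thesis by (rule iffD2)
qed

lemma growth_exp: "growth F (\<lambda>s. exp (- s * \<zeta>)) 0 (- Re \<zeta>)"
  unfolding growth_def
proof (intro allI impI)
  fix \<eta> :: real assume \<eta>: "\<eta> > 0"
  from Im_bounded eventually_Re[OF eventually_ge_at_top[of "Y * \<bar>Im \<zeta>\<bar> / \<eta>"]]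
  show "\<forall>\<^sub>F s in F. norm (exp (- s * \<zeta>)) \<le> exp (0 * (Re s * ln (Re s)) + (- Re \<zeta> + \<eta>) * Re s)"
  proof eventually_elim
    case (elim s)
    have "Im s * Im \<zeta> \<le> \<bar>Im s\<bar> * \<bar>Im \<zeta>\<bar>" by (metis abs_ge_self abs_mult)
    also have "\<dots> \<le> Y * \<bar>Im \<zeta>\<bar>" using elim by (intro mult_right_mono) auto
    also have "\<dots> \<le> \<eta> * Re s" using elim \<eta> by (simp add: field_simps)
    finally show ?case by (simp add: algebra_simps)
  qed
qed

end

text \<open>With the entire function \<open>rGamma\<close> in place of quotients, growth rates
  multiply directly, and holomorphy at the poles of the denominator Gamma-functions is
  immediate.\<close>

lemma fox_integrand_altdef:
  "fox_integrand m n p q a \<alpha> b \<beta> \<zeta> s =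
     (\<Prod>j=1..m. Gamma (b j + of_real (\<beta> j) * s)) *
     (\<Prod>i=1..n. Gamma (1 - a i - of_real (\<alpha> i) * s)) *
     (\<Prod>i=n+1..p. rGamma (a i + of_real (\<alpha> i) * s)) *
     (\<Prod>j=m+1..q. rGamma (1 - b j - of_real (\<beta> j) * s)) * exp (- s * \<zeta>)"
  by (simp add: fox_integrand_def fox_kernel_def rGamma_inverse_Gamma divide_inverse mult.assoc
                prod_inversef[unfolded comp_def])

text \<open>With x = Re s the exponent is \<Delta> x ln x + d x + o(x), where d = ln \<delta> -
  \<Delta> - Re \<zeta>. For \<Delta> < 0 the first term wins against any d; for \<Delta> = 0 the
  hypothesis on |z| = exp (Re \<zeta>) says exactly that d < 0.\<close>

lemma (in right_filter) fox_integrand_decay: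
  assumes "m \<le> q" and "n \<le> p"
    and \<alpha>: "\<And>i. i \<in> {1..p} \<Longrightarrow> \<alpha> i > 0" and \<beta>: "\<And>j. j \<in> {1..q} \<Longrightarrow> \<beta> j > 0"
    and "fox_Delta p q \<alpha> \<beta> < 0 \<or>
         fox_Delta p q \<alpha> \<beta> = 0 \<and> norm (exp \<zeta>) > fox_delta p q \<alpha> \<beta>"
    and "\<epsilon> > 0"
    and far: "\<And>i. i \<in> {1..n} \<Longrightarrow> \<forall>\<^sub>F s in F. \<forall>k. \<epsilon> \<le> dist s (fox_a_pole a \<alpha> i k)"
  obtains \<kappa> where "\<kappa> > 0"
    "\<forall>\<^sub>F s in F. norm (fox_integrand m n p q a \<alpha> b \<beta> \<zeta> s) \<le> exp (- \<kappa> * Re s)"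
proof -
  define A where "A = (\<lambda>i. \<alpha> i - \<alpha> i * ln (\<alpha> i))"
  define B where "B = (\<lambda>j. \<beta> j * ln (\<beta> j) - \<beta> j)"
  have spl: "sum f {1..n} + sum f {n+1..p} = sum f {1..p}"
            "sum f {1..m} + sum f {m+1..q} = sum f {1..q}" for f :: "nat \<Rightarrow> real"
    using sum.ub_add_nat[of 1 n f "p - n"] sum.ub_add_nat[of 1 m f "q - m"] assms(1,2) by simp_all
  have g1: "growth F (\<lambda>s. \<Prod>j=1..m. Gamma (b j + of_real (\<beta> j) * s)) (\<Sum>j=1..m. \<beta> j) (\<Sum>j=1..m. B j)"
    unfolding B_def by (rule growth_prod, simp, rule growth_Gamma, use assms(1) \<beta> in auto)
  have g2: "growth F (\<lambda>s. \<Prod>i=1..n. Gamma (1 - a i - of_real (\<alpha> i) * s)) (\<Sum>i=1..n. - \<alpha> i) (\<Sum>i=1..n. A i)"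
    unfolding A_def
  proof (rule growth_prod)
    fix i assume i: "i \<in> {1..n}"
    then have "\<alpha> i > 0" using assms(2) \<alpha> by auto
    from growth_Gamma_reflected[OF this assms(6) far[OF i, unfolded fox_a_pole_def]]
    show "growth F (\<lambda>s. Gamma (1 - a i - of_real (\<alpha> i) * s)) (- \<alpha> i) (\<alpha> i - \<alpha> i * ln (\<alpha> i))" .
  qed auto
  have g3: "growth F (\<lambda>s. \<Prod>i=n+1..p. rGamma (a i + of_real (\<alpha> i) * s)) (\<Sum>i=n+1..p. - \<alpha> i) (\<Sum>i=n+1..p. A i)"
    unfolding A_def by (rule growth_prod, simp, rule growth_rGamma, use \<alpha> in auto)
  have g4: "growth F (\<lambda>s. \<Prod>j=m+1..q. rGamma (1 - b j - of_real (\<beta> j) * s)) (\<Sum>j=m+1..q. \<beta> j) (\<Sum>j=m+1..q. B j)"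
    unfolding B_def by (rule growth_prod, simp, rule growth_rGamma_reflected, use \<beta> in auto)
  note * = growth_mult[OF growth_mult[OF growth_mult[OF growth_mult[OF g1 g2] g3] g4] growth_exp[of \<zeta>]]
  define d where "d = (\<Sum>i=1..p. A i) + (\<Sum>j=1..q. B j) - Re \<zeta>"
  have aux: "b1 + b2 - (a1 + a2) = b1 + - a1 + - a2 + b2 + 0" and aux2: "a1 + a2 + (b1 + b2) - z = b1 + a1 + a2 + b2 + - z"
    for a1 a2 b1 b2 z :: real by simp_all
  have c_eq: "fox_Delta p q \<alpha> \<beta> =
      (\<Sum>j=1..m. \<beta> j) + (\<Sum>i=1..n. - \<alpha> i) + (\<Sum>i=n+1..p. - \<alpha> i) + (\<Sum>j=m+1..q. \<beta> j) + 0"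
    unfolding fox_Delta_def sum_negf spl(1)[of \<alpha>, symmetric] spl(2)[of \<beta>, symmetric] by (rule aux)
  have d_eq: "d = (\<Sum>j=1..m. B j) + (\<Sum>i=1..n. A i) + (\<Sum>i=n+1..p. A i) + (\<Sum>j=m+1..q. B j) + - Re \<zeta>"
    unfolding d_def spl(1)[of A, symmetric] spl(2)[of B, symmetric] by (rule aux2)
  have eq: "fox_integrand m n p q a \<alpha> b \<beta> \<zeta> = (\<lambda>s.
     (\<Prod>j=1..m. Gamma (b j + of_real (\<beta> j) * s)) *
     (\<Prod>i=1..n. Gamma (1 - a i - of_real (\<alpha> i) * s)) *
     (\<Prod>i=n+1..p. rGamma (a i + of_real (\<alpha> i) * s)) *
     (\<Prod>j=m+1..q. rGamma (1 - b j - of_real (\<beta> j) * s)) * exp (- s * \<zeta>))"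
    by (intro ext fox_integrand_altdef[of m n p q a \<alpha> b \<beta> \<zeta>])
  have gr: "growth F (fox_integrand m n p q a \<alpha> b \<beta> \<zeta>) (fox_Delta p q \<alpha> \<beta>) d"
    unfolding eq c_eq d_eq by (rule *)
  have P: "\<alpha> i powr (- \<alpha> i) > 0" if "i \<in> {1..p}" for i using \<alpha>[OF that] by simp
  have Q: "\<beta> j powr \<beta> j > 0" if "j \<in> {1..q}" for j using \<beta>[OF that] by simp
  have ln_delta: "ln (fox_delta p q \<alpha> \<beta>) = (\<Sum>i=1..p. A i) + (\<Sum>j=1..q. B j) + fox_Delta p q \<alpha> \<beta>"
  proof -
    have "ln (fox_delta p q \<alpha> \<beta>) = (\<Sum>i=1..p. ln (\<alpha> i powr (- \<alpha> i))) + (\<Sum>j=1..q. ln (\<beta> j powr \<beta> j))"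
      unfolding fox_delta_def
      by (simp only: ln_mult_pos[OF prod_pos[OF P] prod_pos[OF Q]]
            ln_prod[OF finite_atLeastAtMost P[THEN less_imp_neq, THEN not_sym]]
            ln_prod[OF finite_atLeastAtMost Q[THEN less_imp_neq, THEN not_sym]])
    also have "\<dots> = (\<Sum>i=1..p. - \<alpha> i * ln (\<alpha> i)) + (\<Sum>j=1..q. \<beta> j * ln (\<beta> j))"
      by (simp add: ln_powr)
    also have "\<dots> = (\<Sum>i=1..p. A i) + (\<Sum>j=1..q. B j) + fox_Delta p q \<alpha> \<beta>"
      by (simp add: A_def B_def fox_Delta_def sum_subtractf sum_negf)
    finally show ?thesis .
  qed
  have delta_pos: "fox_delta p q \<alpha> \<beta> > 0"
    unfolding fox_delta_def by (intro mult_pos_pos prod_pos P Q)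
  from assms(5) show thesis
  proof (elim disjE conjE)
    assume D: "fox_Delta p q \<alpha> \<beta> < 0"
    have "\<forall>\<^sub>F x in at_top. c * (x * ln x) + e * x \<le> - 1 * x" if "c < 0" for c e :: real
      using that by real_asymp
    from this[OF D, of "d + 1"]
    have "\<forall>\<^sub>F x in at_top. fox_Delta p q \<alpha> \<beta> * (x * ln x) + (d + 1) * x \<le> - 1 * x" .
    from eventually_Re[OF this] growthD[OF gr zero_less_one]
    have "\<forall>\<^sub>F s in F. norm (fox_integrand m n p q a \<alpha> b \<beta> \<zeta> s) \<le> exp (- 1 * Re s)"
    proof eventually_elim
      case (elim s)
      note elim(2)
      also have "exp (fox_Delta p q \<alpha> \<beta> * (Re s * ln (Re s)) + (d + 1) * Re s) \<le> exp (- 1 * Re s)"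
        using elim(1) by (rule iffD2[OF exp_le_cancel_iff])
      finally show ?case .
    qed
    with that[of 1] show thesis by simp
  next
    assume D: "fox_Delta p q \<alpha> \<beta> = 0" and "norm (exp \<zeta>) > fox_delta p q \<alpha> \<beta>"
    then have "ln (fox_delta p q \<alpha> \<beta>) < ln (exp (Re \<zeta>))"
      using delta_pos by (subst ln_less_cancel_iff) auto
    with ln_delta D have d: "d < 0" by (simp add: d_def)
    \<comment> \<open>Half of the rate d is sacrificed to absorb the o(x) error.\<close>
    from growthD[OF gr, of "-d/2"] d have
      "\<forall>\<^sub>F s in F. norm (fox_integrand m n p q a \<alpha> b \<beta> \<zeta> s) \<le> exp (- (- d / 2) * Re s)"
      by (simp add: D)
    with that[of "- d / 2"] d show thesis by simp
  qed
qed

section \<open>Residues of the integrand\<close>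

text \<open>At each point \<open>remove_sings\<close> sees only a punctured neighbourhood, so the
  value of H at c has no influence. This turns the derivatives in \<open>fox_Hcoeff\<close> into
  derivatives of explicit analytic functions.\<close>

lemma eventually_remove_sings_eq_analytic:
  assumes "F analytic_on {c}" and "\<forall>\<^sub>F s in at c. H s = F s"
  shows "\<forall>\<^sub>F s in nhds c. remove_sings H s = F s"
proof -
  from assms(2) obtain A where A: "open A" "c \<in> A" "\<And>s. s \<in> A \<Longrightarrow> s \<noteq> c \<Longrightarrow> H s = F s"
    unfolding eventually_at_topological by auto
  have "remove_sings H w = remove_sings F w" if "w \<in> A" for w
  proof (cases "w = c")
    case True
    with assms(2) show ?thesis by (intro remove_sings_cong) auto
  next
    case False
    have "\<forall>\<^sub>F s in at w. s \<in> A - {c}"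
      using A that False by (intro eventually_at_in_open') auto
    then have "\<forall>\<^sub>F s in at w. H s = F s" by eventually_elim (use A in auto)
    then show ?thesis by (intro remove_sings_cong) auto
  qed
  then have "\<forall>\<^sub>F s in nhds c. remove_sings H s = remove_sings F s"
    using eventually_nhds_in_open[OF A(1,2)] by (auto elim: eventually_mono)
  with eventually_remove_sings_eq_nhds[OF assms(1)] show ?thesis
    by eventually_elim simp
qed

lemma eventually_at_not_nonpos_Int: "\<forall>\<^sub>F w in at (w0 :: complex). w \<notin> \<int>\<^sub>\<le>\<^sub>0"
proof (cases "w0 \<in> \<int>\<^sub>\<le>\<^sub>0")
  case False
  have "\<forall>\<^sub>F w in at w0. w \<in> - \<int>\<^sub>\<le>\<^sub>0"
    using False by (intro eventually_at_in_open') (auto simp: open_Compl)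
  then show ?thesis by simp
next
  case True
  then obtain n :: int where n: "w0 = of_int n" by (auto elim: nonpos_Ints_cases)
  have "\<forall>\<^sub>F w in at w0. w \<in> ball w0 1 - {w0}"
    by (intro eventually_at_in_open) auto
  then show ?thesis
  proof eventually_elim
    case (elim w)
    show ?case
    proof
      assume "w \<in> \<int>\<^sub>\<le>\<^sub>0"
      then obtain k :: int where k: "w = of_int k" by (auto elim: nonpos_Ints_cases)
      have "dist w0 w = \<bar>real_of_int (n - k)\<bar>"
        unfolding n k dist_norm by (simp flip: of_int_diff)
      with elim n k show False by auto
    qed
  qed
qed

lemma eventually_at_affine_not_nonpos_Int:
  fixes u v c :: complex
  assumes "v \<noteq> 0"
  shows "\<forall>\<^sub>F s in at c. u + v * s \<notin> \<int>\<^sub>\<le>\<^sub>0"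
proof (rule eventually_compose_filterlim[OF eventually_at_not_nonpos_Int])
  show "filterlim (\<lambda>s. u + v * s) (at (u + v * c)) (at c)"
    unfolding filterlim_at using assms
    by (auto intro!: tendsto_intros simp: eventually_at_filter)
qed

text \<open>The powers of \<zeta>, that is, the logarithms in the expansion, come from here.\<close>

lemma higher_deriv_exp_neg:
  "(deriv ^^ n) (\<lambda>s. exp (- s * \<zeta>)) = (\<lambda>s. (- \<zeta>) ^ n * exp (- s * \<zeta> :: complex))"
proof (induction n)
  case (Suc n)
  have "deriv (\<lambda>s. (- \<zeta>) ^ n * exp (- s * \<zeta>)) s = (- \<zeta>) ^ Suc n * exp (- s * \<zeta>)" for s
    by (rule DERIV_imp_deriv) (auto intro!: derivative_eq_intros)
  then show ?case unfolding funpow.simps comp_def Suc by (rule ext)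
qed simp

locale fox_parameters =
  fixes m n p q :: nat and a b :: "nat \<Rightarrow> complex" and \<alpha> \<beta> :: "nat \<Rightarrow> real" and \<zeta> :: complex
  assumes m_le: "m \<le> q" and n_le: "n \<le> p"
    and \<alpha>_pos: "\<And>i. i \<in> {1..p} \<Longrightarrow> \<alpha> i > 0"
    and \<beta>_pos: "\<And>j. j \<in> {1..q} \<Longrightarrow> \<beta> j > 0"
    and poles_disjoint: "\<And>i j k l :: nat. i \<in> {1..n} \<Longrightarrow> j \<in> {1..m} \<Longrightarrow>
           of_real (\<beta> j) * (a i - 1 - of_nat k) \<noteq> of_real (\<alpha> i) * (b j + of_nat l)"
begin

abbreviation "f \<equiv> fox_integrand m n p q a \<alpha> b \<beta> \<zeta>"
abbreviation "a_pole \<equiv> fox_a_pole a \<alpha>"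
abbreviation "b_pole \<equiv> fox_b_pole b \<beta>"
abbreviation "idx \<equiv> fox_pole_indices n a \<alpha>"

section \<open>Location of the poles and domain of holomorphy\<close>

lemma \<alpha>_pos': "i \<in> {1..n} \<Longrightarrow> \<alpha> i > 0" using \<alpha>_pos n_le by simp
lemma \<beta>_pos': "j \<in> {1..m} \<Longrightarrow> \<beta> j > 0" using \<beta>_pos m_le by simp

lemma a_pole_iff:
  assumes "i \<in> {1..n}"
  shows "1 - a i - of_real (\<alpha> i) * s = - of_nat k \<longleftrightarrow> s = a_pole i k"
  using \<alpha>_pos'[OF assms] by (auto simp: fox_a_pole_def field_simps)

lemma a_pole_iff':
  assumes "i \<in> {1..n}"
  shows "1 - a i - of_real (\<alpha> i) * s \<in> \<int>\<^sub>\<le>\<^sub>0 \<longleftrightarrow> (\<exists>k. s = a_pole i k)"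
  using a_pole_iff[OF assms] by (auto elim!: nonpos_Ints_cases') (metis minus_of_nat_in_nonpos_Ints)+

lemma b_pole_iff:
  assumes "j \<in> {1..m}"
  shows "b j + of_real (\<beta> j) * s = - of_nat l \<longleftrightarrow> s = b_pole j l"
proof -
  have "b j + of_real (\<beta> j) * s = - of_nat l \<longleftrightarrow> of_real (\<beta> j) * s = - (b j + of_nat l)"
    by (auto simp: algebra_simps eq_neg_iff_add_eq_0)
  also have "\<dots> \<longleftrightarrow> s = b_pole j l"
    using \<beta>_pos'[OF assms] unfolding fox_b_pole_def by (subst nonzero_eq_divide_eq) (auto simp: mult.commute)
  finally show ?thesis .
qed

lemma b_pole_iff':
  assumes "j \<in> {1..m}"
  shows "b j + of_real (\<beta> j) * s \<in> \<int>\<^sub>\<le>\<^sub>0 \<longleftrightarrow> (\<exists>l. s = b_pole j l)"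
  using b_pole_iff[OF assms] by (auto elim!: nonpos_Ints_cases') (metis minus_of_nat_in_nonpos_Ints)+

text \<open>The hypothesis \<open>poles_disjoint\<close> is this inequality with the denominators
  cleared.\<close>

lemma a_pole_not_b_pole:
  assumes "i \<in> {1..n}" "j \<in> {1..m}"
  shows "a_pole i k \<noteq> b_pole j l"
proof
  assume eq: "a_pole i k = b_pole j l"
  have "a i - 1 - of_nat k = - (of_real (\<alpha> i) * a_pole i k)"
    using a_pole_iff[OF assms(1), of "a_pole i k" k] by (simp add: algebra_simps)
  moreover have "b j + of_nat l = - (of_real (\<beta> j) * a_pole i k)"
    using b_pole_iff[OF assms(2), of "a_pole i k" l] eq by (simp add: algebra_simps eq_neg_iff_add_eq_0)
  ultimately have "of_real (\<beta> j) * (a i - 1 - of_nat k) = of_real (\<alpha> i) * (b j + of_nat l)"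
    by simp
  with poles_disjoint[OF assms] show False by blast
qed

lemma a_pole_inj: "i \<in> {1..n} \<Longrightarrow> a_pole i k = a_pole i k' \<longleftrightarrow> k = k'"
  using \<alpha>_pos' by (fastforce simp: fox_a_pole_def)

definition "regular = {s. (\<forall>i\<in>{1..n}. \<forall>k. s \<noteq> a_pole i k) \<and> (\<forall>j\<in>{1..m}. \<forall>l. s \<noteq> b_pole j l)}"

text \<open>Infinitely many excluded points become finitely many affine preimages of one closed set;
  openness and holomorphy are read off from this form.\<close>

lemma regular_altdef:
  "regular = (\<Inter>i\<in>{1..n}. {s. 1 - a i - of_real (\<alpha> i) * s \<in> - \<int>\<^sub>\<le>\<^sub>0}) \<inter>
         (\<Inter>j\<in>{1..m}. {s. b j + of_real (\<beta> j) * s \<in> - \<int>\<^sub>\<le>\<^sub>0})"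
  using a_pole_iff' b_pole_iff' by (auto simp: regular_def)

lemma open_regular: "open regular"
  unfolding regular_altdef
  by (intro open_Int open_INT ballI finite_atLeastAtMost
        open_vimage[of "- \<int>\<^sub>\<le>\<^sub>0", unfolded vimage_def] continuous_intros)
     (auto simp: open_Compl)

lemma f_holomorphic: "f holomorphic_on regular"
  unfolding fox_integrand_altdef[abs_def]
  by (intro holomorphic_intros) (auto simp: regular_altdef)

text \<open>
  Around a pole \<open>c\<close>, the kernel is \<open>regular_part c s * singular_part c \<kappa> s / (s - c) ^ N\<close>, where
  \<open>\<kappa> r\<close> is the index with \<open>c = a_pole r (\<kappa> r)\<close>. The Gamma-functions with a pole at \<open>c\<close> are continued
  by \<open>\<Gamma>(w) = \<Gamma>(w + k + 1) / (w (w + 1) \<cdots> (w + k))\<close>, whose last factor is \<open>- \<alpha> r * (s - c)\<close>.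
\<close>

definition regular_part :: "complex \<Rightarrow> complex \<Rightarrow> complex" where
  "regular_part c s = (\<Prod>j=1..m. Gamma (b j + of_real (\<beta> j) * s)) *
     (\<Prod>i\<in>{1..n} - idx c. Gamma (1 - a i - of_real (\<alpha> i) * s)) *
     (\<Prod>i=n+1..p. rGamma (a i + of_real (\<alpha> i) * s)) *
     (\<Prod>j=m+1..q. rGamma (1 - b j - of_real (\<beta> j) * s))"

definition singular_part :: "complex \<Rightarrow> (nat \<Rightarrow> nat) \<Rightarrow> complex \<Rightarrow> complex" where
  "singular_part c \<kappa> s = (\<Prod>r\<in>idx c. - 1 / of_real (\<alpha> r) *
     Gamma (1 - a r - of_real (\<alpha> r) * s + of_nat (\<kappa> r) + 1) /
     (\<Prod>i<\<kappa> r. 1 - a r - of_real (\<alpha> r) * s + of_nat i))"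

lemma finite_idx: "finite (idx c)" and idx_subset: "idx c \<subseteq> {1..n}"
  by (auto simp: fox_pole_indices_def)

lemma regular_part_analytic:
  assumes "i \<in> {1..n}" "c = a_pole i k"
  shows "regular_part c analytic_on {c}"
proof -
  have "b j + of_real (\<beta> j) * c \<notin> \<int>\<^sub>\<le>\<^sub>0" if "j \<in> {1..m}" for j
    using b_pole_iff'[OF that] a_pole_not_b_pole[OF assms(1) that] assms(2) by auto
  moreover have "1 - a r - of_real (\<alpha> r) * c \<notin> \<int>\<^sub>\<le>\<^sub>0" if "r \<in> {1..n} - idx c" for r
    using a_pole_iff'[of r c] that by (auto simp: fox_pole_indices_def)
  ultimately show ?thesis
    unfolding regular_part_def[abs_def] by (intro analytic_intros) auto
qed

text \<open>At s = c the shifted Gamma-function has the argument 1, and the factors left in the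
  denominator are - \<kappa> r + i with i < \<kappa> r, which do not vanish.\<close>

lemma singular_part_analytic:
  assumes "\<And>r. r \<in> idx c \<Longrightarrow> c = a_pole r (\<kappa> r)"
  shows "singular_part c \<kappa> analytic_on {c}"
proof -
  have "1 - a r - of_real (\<alpha> r) * c = - of_nat (\<kappa> r)" if "r \<in> idx c" for r
    using a_pole_iff[of r c "\<kappa> r"] assms[OF that] that idx_subset[of c] by auto
  moreover have "- of_nat k + of_nat i \<noteq> (0 :: complex)" if "i < k" for i k :: nat
    using that by (simp add: add_eq_0_iff)
  ultimately show ?thesis
    unfolding singular_part_def[abs_def] using idx_subset[of c] \<alpha>_pos'
    by (intro analytic_intros) auto
qed

lemma eventually_at_regular: "\<forall>\<^sub>F s in at c. s \<in> regular"
proof -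
  have "\<forall>\<^sub>F s in at c. 1 - a i - of_real (\<alpha> i) * s \<notin> \<int>\<^sub>\<le>\<^sub>0" if "i \<in> {1..n}" for i
    using eventually_at_affine_not_nonpos_Int[of "- of_real (\<alpha> i)" "1 - a i" c] \<alpha>_pos'[OF that] by simp
  moreover have "\<forall>\<^sub>F s in at c. b j + of_real (\<beta> j) * s \<notin> \<int>\<^sub>\<le>\<^sub>0" if "j \<in> {1..m}" for j
    using eventually_at_affine_not_nonpos_Int[of "of_real (\<beta> j)" "b j" c] \<beta>_pos'[OF that] by simp
  ultimately have "\<forall>\<^sub>F s in at c. (\<forall>i\<in>{1..n}. 1 - a i - of_real (\<alpha> i) * s \<notin> \<int>\<^sub>\<le>\<^sub>0) \<and>
      (\<forall>j\<in>{1..m}. b j + of_real (\<beta> j) * s \<notin> \<int>\<^sub>\<le>\<^sub>0)"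
    by (intro eventually_conj eventually_ball_finite) auto
  then show ?thesis by eventually_elim (auto simp: regular_altdef)
qed

text \<open>At a pole c itself the power of s - c makes \<open>fox_H1\<close> vanish, while
  \<open>singular_part\<close> takes the limit value; so the two agree only off c.\<close>

lemma singular_part_eq:
  assumes "\<And>r. r \<in> idx c \<Longrightarrow> c = a_pole r (\<kappa> r)" and s: "s \<in> regular" "s \<noteq> c"
  shows "singular_part c \<kappa> s = fox_H1 n a \<alpha> c s"
proof -
  have "fox_H1 n a \<alpha> c s = (\<Prod>r\<in>idx c. (s - c) * Gamma (1 - a r - of_real (\<alpha> r) * s))"
    by (simp add: fox_H1_def prod.distrib)
  also have "\<dots> = singular_part c \<kappa> s"
    unfolding singular_part_def
  proof (rule prod.cong[OF refl])
    fix r assume r: "r \<in> idx c"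
    define w where "w = 1 - a r - of_real (\<alpha> r) * s"
    have rn: "r \<in> {1..n}" using r idx_subset by blast
    have w: "w \<notin> \<int>\<^sub>\<le>\<^sub>0" using s rn unfolding w_def by (auto simp: regular_altdef)
    have al: "\<alpha> r \<noteq> 0" using \<alpha>_pos'[OF rn] by simp
    have "1 - a r = of_real (\<alpha> r) * c - of_nat (\<kappa> r)"
      using a_pole_iff[OF rn, of c "\<kappa> r"] assms(1)[OF r] by (simp add: algebra_simps)
    then have sc: "w + of_nat (\<kappa> r) = - of_real (\<alpha> r) * (s - c)"
      by (simp add: w_def algebra_simps)
    have pnz: "pochhammer w (\<kappa> r) \<noteq> 0" using w pochhammer_eq_0_imp_nonpos_Int by blast
    have "Gamma (w + of_nat (\<kappa> r) + 1) = Gamma (w + of_nat (Suc (\<kappa> r)))" by (simp add: add_ac)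
    also have "\<dots> = pochhammer w (Suc (\<kappa> r)) * Gamma w"
      using pochhammer_Gamma[OF w, of "Suc (\<kappa> r)"] w by (simp add: Gamma_eq_zero_iff)
    also have "pochhammer w (Suc (\<kappa> r)) = pochhammer w (\<kappa> r) * (w + of_nat (\<kappa> r))"
      by (simp add: pochhammer_Suc)
    finally have "Gamma (w + of_nat (\<kappa> r) + 1) =
        pochhammer w (\<kappa> r) * (- of_real (\<alpha> r) * (s - c)) * Gamma w" unfolding sc .
    then have "- 1 / of_real (\<alpha> r) * Gamma (w + of_nat (\<kappa> r) + 1) / pochhammer w (\<kappa> r) = (s - c) * Gamma w"
      using pnz al by (simp add: field_simps)
    then show "(s - c) * Gamma (1 - a r - of_real (\<alpha> r) * s) = - 1 / of_real (\<alpha> r) *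
        Gamma (1 - a r - of_real (\<alpha> r) * s + of_nat (\<kappa> r) + 1) /
        (\<Prod>i<\<kappa> r. 1 - a r - of_real (\<alpha> r) * s + of_nat i)"
      by (simp add: w_def pochhammer_prod lessThan_atLeast0)
  qed
  finally show ?thesis by simp
qed

lemma kernel_eq:
  "fox_kernel m n p q a \<alpha> b \<beta> s = regular_part c s * (\<Prod>r\<in>idx c. Gamma (1 - a r - of_real (\<alpha> r) * s))"
proof -
  have "(\<Prod>i=1..n. Gamma (1 - a i - of_real (\<alpha> i) * s)) =
     (\<Prod>i\<in>{1..n} - idx c. Gamma (1 - a i - of_real (\<alpha> i) * s)) *
     (\<Prod>r\<in>idx c. Gamma (1 - a r - of_real (\<alpha> r) * s))"
    using idx_subset by (intro prod.subset_diff) auto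
  then show ?thesis
    by (simp add: fox_kernel_def regular_part_def rGamma_inverse_Gamma divide_inverse prod_inversef[unfolded comp_def])
qed

lemma regular_part_eq:
  assumes "s \<in> regular"
  shows "fox_H2 m n p q a \<alpha> b \<beta> c s = regular_part c s"
proof -
  have "(\<Prod>r\<in>idx c. Gamma (1 - a r - of_real (\<alpha> r) * s)) \<noteq> 0"
    using assms idx_subset[of c] finite_idx[of c] by (auto simp: Gamma_eq_zero_iff regular_altdef)
  then show ?thesis unfolding fox_H2_def kernel_eq[of s c] by simp
qed

lemma f_eq:
  assumes "s \<noteq> c"
  shows "f s = fox_H1 n a \<alpha> c s * regular_part c s * exp (- s * \<zeta>) / (s - c) ^ card (idx c)"
  using assms unfolding fox_integrand_def kernel_eq[of s c] fox_H1_def by simp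

lemma residue_f:
  assumes "i \<in> {1..n}" "c = a_pole i k" "\<And>r. r \<in> idx c \<Longrightarrow> c = a_pole r (\<kappa> r)"
  shows "residue f c = (deriv ^^ (card (idx c) - 1)) (\<lambda>s. singular_part c \<kappa> s * regular_part c s * exp (- s * \<zeta>)) c /
                       fact (card (idx c) - 1)"
proof -
  \<comment> \<open>A pole belongs to its own index set, so its order is at least 1 and the
    subtraction of 1 on natural numbers is genuine.\<close>
  have "i \<in> idx c" using assms(1,2) by (auto simp: fox_pole_indices_def)
  then have N: "card (idx c) = Suc (card (idx c) - 1)"
    using finite_idx[of c] by (metis One_nat_def Suc_pred card_gt_0_iff empty_iff)
  have "(\<lambda>s. singular_part c \<kappa> s * regular_part c s * exp (- s * \<zeta>)) analytic_on {c}"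
    using assms by (intro analytic_intros singular_part_analytic regular_part_analytic) auto
  then obtain S where S: "open S" "c \<in> S" "(\<lambda>s. singular_part c \<kappa> s * regular_part c s * exp (- s * \<zeta>)) holomorphic_on S"
    by (auto simp: analytic_at)
  have "\<forall>\<^sub>F s in at c. s \<noteq> c" by (simp add: eventually_at_filter)
  with eventually_at_regular[of c]
  have "\<forall>\<^sub>F s in at c. f s = singular_part c \<kappa> s * regular_part c s * exp (- s * \<zeta>) / (s - c) ^ Suc (card (idx c) - 1)"
  proof eventually_elim
    case (elim s)
    then show ?case using f_eq[of s c] singular_part_eq[OF assms(3) elim] N by simp
  qed
  then have "residue f c = residue (\<lambda>s. singular_part c \<kappa> s * regular_part c s * exp (- s * \<zeta>) / (s - c) ^ Suc (card (idx c) - 1)) c"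
    by (intro residue_cong refl)
  also have "\<dots> = (deriv ^^ (card (idx c) - 1)) (\<lambda>s. singular_part c \<kappa> s * regular_part c s * exp (- s * \<zeta>)) c /
                       fact (card (idx c) - 1)"
    by (rule residue_holomorphic_over_power[OF S])
  finally show ?thesis .
qed

section \<open>The terms of the expansion as negative residues\<close>

lemma obtain_multiplicities:
  obtains \<kappa> where "\<And>r. r \<in> idx c \<Longrightarrow> c = a_pole r (\<kappa> r)"
proof -
  have "\<forall>r\<in>idx c. \<exists>k. c = a_pole r k" by (auto simp: fox_pole_indices_def)
  with that show thesis by (metis (no_types))
qed

text \<open>\<open>T1\<close> and \<open>T2\<close> copy the summands of the theorem literally, so
  that its goal folds into them.\<close>

definition T1 :: "nat \<times> nat \<Rightarrow> complex" where
  "T1 = (\<lambda>(i, k). fox_h m n p q a \<alpha> b \<beta> i k * exp ((a i - 1 - of_nat k) / of_real (\<alpha> i) * \<zeta>))"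

definition T2 :: "nat \<times> nat \<Rightarrow> complex" where
  "T2 = (\<lambda>(i, k). \<Sum>j=0..fox_N n a \<alpha> i k - 1. fox_Hcoeff m n p q a \<alpha> b \<beta> i k j *
          exp ((a i - 1 - of_nat k) / of_real (\<alpha> i) * \<zeta>) * \<zeta> ^ j)"

lemma exp_a_pole: "exp ((a i - 1 - of_nat k) / of_real (\<alpha> i) * \<zeta>) = exp (- a_pole i k * \<zeta>)"
proof -
  have "(a i - 1 - of_nat k) / of_real (\<alpha> i) = - a_pole i k"
    unfolding fox_a_pole_def minus_divide_left by simp
  then show ?thesis by simp
qed

lemma T1_eq:
  assumes i: "i \<in> {1..n}" and "fox_N n a \<alpha> i k = 1"
  shows "T1 (i, k) = - residue f (a_pole i k)"
proof -
  define c where "c = a_pole i k"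
  have "card (idx c) = 1" and "i \<in> idx c"
    using assms by (auto simp: c_def fox_N_def fox_pole_indices_def)
  then have idx: "idx c = {i}" by (metis card_1_singletonE singletonD)
  have c: "1 - a i - of_real (\<alpha> i) * c = - of_nat k"
    using a_pole_iff[OF i] by (simp add: c_def)
  have *: "c = a_pole r k" if "r \<in> idx c" for r using that[unfolded idx] by (simp add: c_def)
  have "residue f c = singular_part c (\<lambda>_. k) c * regular_part c c * exp (- c * \<zeta>)"
    using residue_f[OF i c_def *] by (simp add: idx)
  \<comment> \<open>At c the shifted Gamma-function is Gamma 1 = 1, and the denominator is the
    product of the numbers from - k to - 1.\<close>
  also have "singular_part c (\<lambda>_. k) c = - 1 / of_real (\<alpha> i) / pochhammer (- of_nat k) k"
    by (simp add: singular_part_def idx c pochhammer_prod lessThan_atLeast0)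
  also have "\<dots> = - ((-1) ^ k / (fact k * of_real (\<alpha> i)))"
    by (cases "even k") (simp_all add: pochhammer_same field_simps)
  finally have "- residue f c = (-1) ^ k / (fact k * of_real (\<alpha> i)) * regular_part c c * exp (- c * \<zeta>)"
    by simp
  \<comment> \<open>The Gamma arguments in \<open>fox_h\<close> are those of
    \<open>regular_part\<close>, taken at c.\<close>
  moreover have ratio: "(1 - a i + of_nat k) * of_real (x / \<alpha> i) = of_real x * c" for x
    by (simp add: c_def fox_a_pole_def)
  have "fox_h m n p q a \<alpha> b \<beta> i k = (-1) ^ k / (fact k * of_real (\<alpha> i)) * regular_part c c"
    unfolding fox_h_def ratio regular_part_def idx
    by (simp add: rGamma_inverse_Gamma divide_inverse prod_inversef[unfolded comp_def])
  ultimately show ?thesis unfolding T1_def prod.case exp_a_pole by (simp add: c_def)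
qed

text \<open>Leibniz' rule is used twice: it splits off \<open>singular_part\<close>, then separates
  exp from \<open>regular_part\<close>. Exchanging the order of summation over the triangle j \<le>
  \<nu> \<le> N collects the powers \<zeta> ^ j.\<close>

lemma T2_eq:
  assumes i: "i \<in> {1..n}"
  shows "T2 (i, k) = - residue f (a_pole i k)"
proof -
  define c where "c = a_pole i k"
  \<comment> \<open>\<open>N\<close> is one less than the order of the pole, the number of
    derivatives in the residue.\<close>
  define N where "N = card (idx c) - 1"
  obtain \<kappa> where \<kappa>: "\<And>r. r \<in> idx c \<Longrightarrow> c = a_pole r (\<kappa> r)" using obtain_multiplicities by blast
  note an = singular_part_analytic[OF \<kappa>] regular_part_analytic[OF i c_def]
  define D1 where "D1 = (\<lambda>j. (deriv ^^ j) (singular_part c \<kappa>) c)"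
  define D2 where "D2 = (\<lambda>j. (deriv ^^ j) (regular_part c) c)"
  have nc: "\<forall>\<^sub>F s in at c. s \<noteq> c" by (simp add: eventually_at_filter)
  have "\<forall>\<^sub>F s in at c. fox_H1 n a \<alpha> c s = singular_part c \<kappa> s"
    using eventually_at_regular[of c] nc by eventually_elim (simp add: singular_part_eq \<kappa>)
  from eventually_remove_sings_eq_analytic[OF an(1) this]
  have D1: "(deriv ^^ j) (remove_sings (fox_H1 n a \<alpha> c)) c = D1 j" for j
    unfolding D1_def by (intro higher_deriv_cong_ev refl) auto
  have "\<forall>\<^sub>F s in at c. fox_H2 m n p q a \<alpha> b \<beta> c s = regular_part c s"
    using eventually_at_regular[of c] by eventually_elim (rule regular_part_eq)
  from eventually_remove_sings_eq_analytic[OF an(2) this]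
  have D2: "(deriv ^^ j) (remove_sings (fox_H2 m n p q a \<alpha> b \<beta> c)) c = D2 j" for j
    unfolding D2_def by (intro higher_deriv_cong_ev refl) auto
  have res: "residue f c = (deriv ^^ N) (\<lambda>s. singular_part c \<kappa> s * regular_part c s * exp (- s * \<zeta>)) c / fact N"
    unfolding N_def by (rule residue_f[OF i c_def \<kappa>])
  have an3: "(\<lambda>s. exp (- s * \<zeta>)) analytic_on {c}" by (intro analytic_intros)
  have "(deriv ^^ N) (\<lambda>s. singular_part c \<kappa> s * regular_part c s * exp (- s * \<zeta>)) c =
        (deriv ^^ N) (\<lambda>s. (regular_part c s * exp (- s * \<zeta>)) * singular_part c \<kappa> s) c"
    by (simp add: mult_ac)
  also have "\<dots> = (\<Sum>\<nu>=0..N. of_nat (N choose \<nu>) * (deriv ^^ \<nu>) (\<lambda>s. exp (- s * \<zeta>) * regular_part c s) c * D1 (N - \<nu>))"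
    unfolding D1_def using an an3
    by (subst higher_deriv_mult_at) (auto intro!: analytic_intros simp: mult.commute)
  also have "\<dots> = (\<Sum>\<nu>=0..N. of_nat (N choose \<nu>) *
      (\<Sum>j=0..\<nu>. of_nat (\<nu> choose j) * ((- \<zeta>) ^ j * exp (- c * \<zeta>)) * D2 (\<nu> - j)) * D1 (N - \<nu>))"
    unfolding D2_def by (simp only: higher_deriv_mult_at[OF an3 an(2)] higher_deriv_exp_neg)
  also have "\<dots> = (\<Sum>\<nu>=0..N. \<Sum>j=0..\<nu>. (-1) ^ j * of_nat (N choose \<nu>) * of_nat (\<nu> choose j) * D1 (N - \<nu>) *
      D2 (\<nu> - j) * exp (- c * \<zeta>) * \<zeta> ^ j)"
    unfolding sum_distrib_left sum_distrib_right
    by (intro sum.cong refl) (simp add: power_minus[of \<zeta>] mult_ac)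
  also have "\<dots> = (\<Sum>j=0..N. \<Sum>\<nu>=j..N. (-1) ^ j * of_nat (N choose \<nu>) * of_nat (\<nu> choose j) * D1 (N - \<nu>) *
      D2 (\<nu> - j) * exp (- c * \<zeta>) * \<zeta> ^ j)"
    unfolding sum.Sigma[OF finite_atLeastAtMost ballI[OF finite_atLeastAtMost]]
    by (rule sum.reindex_bij_witness[of _ "\<lambda>(x, y). (y, x)" "\<lambda>(x, y). (y, x)"]) auto
  finally have "- residue f c = (\<Sum>j=0..N. - (1 / fact N * (\<Sum>\<nu>=j..N. (-1) ^ j * of_nat (N choose \<nu>) * of_nat (\<nu> choose j) * D1 (N - \<nu>) *
      D2 (\<nu> - j))) * exp (- c * \<zeta>) * \<zeta> ^ j)"
    by (simp add: res sum_negf sum_distrib_right sum_divide_distrib sum_distrib_left)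
  then show ?thesis
    unfolding T2_def prod.case exp_a_pole
    by (simp add: fox_N_def fox_Hcoeff_def Let_def D1 D2 N_def flip: c_def)
qed

end

section \<open>Loops closed by a vertical segment\<close>

text \<open>The closed loops contain truncated half-lines, hence the second claim; the tail beyond T
  is at most K * exp (- \<kappa> * T) / \<kappa>.\<close>

lemma half_line_integral:
  fixes h :: "real \<Rightarrow> complex"
  assumes cont: "continuous_on {0..} h" and "\<kappa> > 0" "T0 \<ge> 0"
    and decay: "\<And>t. t \<ge> T0 \<Longrightarrow> norm (h t) \<le> C * exp (- \<kappa> * t)"
  shows "h integrable_on {0..}"
    and "((\<lambda>T. integral {0..T} h) \<longlongrightarrow> integral {0..} h) at_top"
proof -
  have "continuous_on {0..T0} h" using cont by (rule continuous_on_subset) auto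
  then have "bounded (h ` {0..T0})" by (intro compact_imp_bounded compact_continuous_image) auto
  then obtain B where B: "\<And>t. t \<in> {0..T0} \<Longrightarrow> norm (h t) \<le> B"
    unfolding bounded_iff by fastforce
  \<comment> \<open>The second term extends the exponential bound to the compact interval [0, T0],
    where exp (\<kappa> * T0) * exp (- \<kappa> * t) \<ge> 1.\<close>
  define K where "K = max \<bar>C\<bar> (\<bar>B\<bar> * exp (\<kappa> * T0))"
  have bound: "norm (h t) \<le> K * exp (- \<kappa> * t)" if "t \<ge> 0" for t
  proof (cases "t \<ge> T0")
    case True
    have "norm (h t) \<le> C * exp (- \<kappa> * t)" using decay True .
    also have "\<dots> \<le> K * exp (- \<kappa> * t)" by (intro mult_right_mono) (auto simp: K_def)
    finally show ?thesis .
  next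
    case False
    have "norm (h t) \<le> \<bar>B\<bar> * 1" using B[of t] that False by auto
    also have "\<dots> \<le> \<bar>B\<bar> * (exp (\<kappa> * T0) * exp (- \<kappa> * t))"
      using that False assms(2) by (intro mult_left_mono) (auto simp flip: exp_add)
    also have "\<dots> = (\<bar>B\<bar> * exp (\<kappa> * T0)) * exp (- \<kappa> * t)" by (rule mult.assoc[symmetric])
    also have "\<dots> \<le> K * exp (- \<kappa> * t)" by (intro mult_right_mono) (auto simp: K_def)
    finally show ?thesis .
  qed
  have KI: "((\<lambda>t. K * exp (- \<kappa> * t)) has_integral K * (exp (- \<kappa> * c) / \<kappa>)) {c..}" for c
    by (intro has_integral_mult_right has_integral_exp_minus_to_infinity assms)
  have int: "h absolutely_integrable_on {c..}" if "c \<ge> 0" for c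
  proof (rule measurable_bounded_by_integrable_imp_absolutely_integrable)
    show "h \<in> borel_measurable (lebesgue_on {c..})"
      using that by (intro continuous_imp_measurable_on_sets_lebesgue continuous_on_subset[OF cont]) auto
    show "(\<lambda>t. K * exp (- \<kappa> * t)) integrable_on {c..}" using KI by blast
    show "norm (h t) \<le> K * exp (- \<kappa> * t)" if "t \<in> {c..}" for t
      using bound that \<open>c \<ge> 0\<close> by auto
  qed auto
  have int': "h integrable_on {c..}" if "c \<ge> 0" for c
    using int[OF that] by (rule set_lebesgue_integral_eq_integral)
  then show "h integrable_on {0..}" by simp
  have "\<forall>\<^sub>F T in at_top. norm (integral {0..T} h - integral {0..} h) \<le> K * (exp (- \<kappa> * T) / \<kappa>)"
    using eventually_ge_at_top[of 0]
  proof eventually_elim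
    case (elim T)
    have 1: "h integrable_on {0..T}" by (rule integrable_on_subinterval[OF int'[of 0]]) auto
    have un: "{0..T} \<union> {T..} = {0..}" using elim by auto
    have "{0..T} \<inter> {T..} \<subseteq> {T}" by auto
    then have "negligible ({0..T} \<inter> {T..})" by (rule negligible_subset[OF negligible_sing])
    from integral_Un[OF 1 int'[OF elim] this] have "integral {0..} h = integral {0..T} h + integral {T..} h"
      unfolding un .
    then have "norm (integral {0..T} h - integral {0..} h) = norm (integral {T..} h)"
      by simp
    also have "\<dots> \<le> integral {T..} (\<lambda>t. K * exp (- \<kappa> * t))"
      using bound elim KI by (intro integral_norm_bound_integral int') auto
    also have "\<dots> = K * (exp (- \<kappa> * T) / \<kappa>)" using KI by (rule integral_unique)
    finally show ?case .
  qed
  moreover have "((\<lambda>T. K * (exp (- \<kappa> * T) / \<kappa>)) \<longlongrightarrow> 0) at_top"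
    using assms(2) by real_asymp
  ultimately have "((\<lambda>T. integral {0..T} h - integral {0..} h) \<longlongrightarrow> 0) at_top"
    by (rule Lim_null_comparison)
  then show "((\<lambda>T. integral {0..T} h) \<longlongrightarrow> integral {0..} h) at_top"
    by (rule LIM_zero_cancel)
qed

lemma contour_integral_linepath_horizontal:
  assumes "L > 0" and "continuous_on (closed_segment s (s + of_real L)) f"
  shows "contour_integral (linepath s (s + of_real L)) f = integral {0..L} (\<lambda>t. f (s + of_real t))"
proof -
  have "s + of_real t \<in> closed_segment s (s + of_real L)" if "t \<in> {0..L}" for t
  proof -
    have "s + of_real t = (1 - t / L) *\<^sub>R s + (t / L) *\<^sub>R (s + of_real L)"
      using assms(1) by (simp add: scaleR_conv_of_real field_simps)
    moreover have "0 \<le> t / L" "t / L \<le> 1" using that assms(1) by auto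
    ultimately show ?thesis unfolding in_segment by blast
  qed
  then have "continuous_on {0..L} (\<lambda>t. f (s + of_real t))"
    by (intro continuous_on_compose2[OF assms(2)] continuous_intros) auto
  then have "((\<lambda>t. f (s + of_real t)) has_integral integral {0..L} (\<lambda>t. f (s + of_real t))) {0..L}"
    by (intro integrable_integral integrable_continuous_interval)
  from has_integral_stretch_real[OF this, of L] assms(1)
  have "((\<lambda>x. f (s + of_real (L * x))) has_integral (1 / L) *\<^sub>R integral {0..L} (\<lambda>t. f (s + of_real t)))
          ((\<lambda>x. x / L) ` {0..L})" by simp
  also have "(\<lambda>x. x / L) ` {0..L} = {0..1}"
    using assms(1) by simp
  finally have "((\<lambda>x. f (s + of_real (L * x)) * of_real L) has_integral
      (1 / L) *\<^sub>R integral {0..L} (\<lambda>t. f (s + of_real t)) * of_real L) {0..1}"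
    by (rule has_integral_mult_left)
  then have "(f has_contour_integral integral {0..L} (\<lambda>t. f (s + of_real t))) (linepath s (s + of_real L))"
    unfolding has_contour_integral_linepath using assms(1)
    by (simp add: linepath_def scaleR_conv_of_real algebra_simps)
  then show ?thesis by (rule contour_integral_unique)
qed

text \<open>Beyond \<open>X0\<close>, which lies to the right of the finite part \<open>g\<close>,
  moving the vertical side changes the closed loop only along the half-lines. \<open>P0\<close> and
  \<open>P1\<close> are its corners.\<close>

locale right_loop =
  fixes g :: "real \<Rightarrow> complex" and X0 :: real
  assumes valid: "valid_path g" and Re_less: "\<And>s. s \<in> path_image g \<Longrightarrow> Re s < X0"
begin

abbreviation "s0 \<equiv> pathstart g"
abbreviation "s1 \<equiv> pathfinish g"
abbreviation "P0 X \<equiv> Complex X (Im s0)"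
abbreviation "P1 X \<equiv> Complex X (Im s1)"

lemma Re_ends: "Re s0 < X0" "Re s1 < X0"
  using Re_less by auto

lemma path_image_closed_loop:
  "path_image (closed_loop g X) = closed_segment (P0 X) s0 \<union> path_image g \<union>
     closed_segment s1 (P1 X) \<union> closed_segment (P1 X) (P0 X)"
  unfolding closed_loop_def by (simp add: path_image_join Un_assoc)

lemma valid_closed_loop: "valid_path (closed_loop g X)"
  unfolding closed_loop_def using valid by (intro valid_path_join) auto

lemma loop_closed_loop: "pathfinish (closed_loop g X) = pathstart (closed_loop g X)"
  by (simp add: closed_loop_def)

lemma contour_integral_closed_loop:
  assumes "f holomorphic_on D" "open D" "path_image (closed_loop g X) \<subseteq> D"
  shows "contour_integral (closed_loop g X) f =
     contour_integral (linepath (P0 X) s0) f + contour_integral g f +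
     contour_integral (linepath s1 (P1 X)) f + contour_integral (linepath (P1 X) (P0 X)) f"
proof -
  have ci: "f contour_integrable_on \<gamma>" if "valid_path \<gamma>" "path_image \<gamma> \<subseteq> path_image (closed_loop g X)" for \<gamma>
    using contour_integrable_holomorphic_simple[OF assms(1,2) that(1)] that(2) assms(3) by auto
  then have "f contour_integrable_on linepath (P0 X) s0" "f contour_integrable_on g"
    "f contour_integrable_on linepath s1 (P1 X)" "f contour_integrable_on linepath (P1 X) (P0 X)"
    using valid by (auto intro!: ci simp: path_image_closed_loop)
  then show ?thesis
    unfolding closed_loop_def using valid
    by (simp add: valid_path_join contour_integrable_joinI)
qed

text \<open>The incoming half-line is traversed towards the left, hence the minus sign. Apart from
  the vertical side this is a truncation of \<open>loop_integral\<close>.\<close>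

lemma contour_integral_closed_loop':
  assumes "f holomorphic_on D" "open D" "path_image (closed_loop g X) \<subseteq> D" "X > X0"
  shows "contour_integral (closed_loop g X) f =
     - integral {0..X - Re s0} (\<lambda>t. f (s0 + of_real t)) + contour_integral g f +
     integral {0..X - Re s1} (\<lambda>t. f (s1 + of_real t)) + contour_integral (linepath (P1 X) (P0 X)) f"
proof -
  have P: "P0 X = s0 + of_real (X - Re s0)" "P1 X = s1 + of_real (X - Re s1)"
    by (simp_all add: complex_eq_iff)
  have c: "continuous_on (closed_segment s0 (P0 X)) f" "continuous_on (closed_segment s1 (P1 X)) f"
    using assms(1,3) unfolding path_image_closed_loop
    by (auto intro!: holomorphic_on_imp_continuous_on holomorphic_on_subset[OF assms(1)]
          simp: closed_segment_commute[of s0])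
  have "contour_integral (linepath (P0 X) s0) f = - contour_integral (linepath s0 (P0 X)) f"
    using contour_integral_reverse_linepath[OF c(1)] by simp
  with contour_integral_linepath_horizontal[of "X - Re s0" s0 f, folded P(1)]
    contour_integral_linepath_horizontal[of "X - Re s1" s1 f, folded P(2)]
    contour_integral_closed_loop[OF assms(1-3)] c Re_ends assms(4)
  show ?thesis by simp
qed

lemma Re_vertical: "s \<in> closed_segment (P1 X) (P0 X) \<Longrightarrow> Re s = X"
  using closed_segment_same_Re[of "P1 X" "P0 X"] by simp

lemma P_in_segment:
  assumes "X0 < X" "X \<le> X'"
  shows "P0 X \<in> closed_segment (P0 X') s0" "P1 X \<in> closed_segment s1 (P1 X')"
  using assms Re_ends by (auto simp: closed_segment_same_Im closed_segment_eq_real_ivl)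

lemma path_image_closed_loop_mono:
  assumes "X0 < X" "X \<le> X'"
  shows "path_image (closed_loop g X) \<subseteq> path_image (closed_loop g X') \<union> closed_segment (P1 X) (P0 X)"
proof -
  have "closed_segment (P0 X) s0 \<subseteq> closed_segment (P0 X') s0" "closed_segment s1 (P1 X) \<subseteq> closed_segment s1 (P1 X')"
    using P_in_segment[OF assms] by (auto simp: subset_closed_segment)
  then show ?thesis unfolding path_image_closed_loop by auto
qed

text \<open>The two loops differ by the boundary of a rectangle with corners in C. On the convex set
  C there is a primitive h, so the contributions of its sides telescope.\<close>

lemma contour_integral_closed_loop_extend:
  assumes f: "f holomorphic_on D" "open D" and sub: "path_image (closed_loop g X) \<subseteq> D"
    "path_image (closed_loop g X') \<subseteq> D"
    and C: "f holomorphic_on C" "convex C" "open C" "{P0 X, P1 X, P0 X', P1 X'} \<subseteq> C"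
    and X: "X0 < X" "X \<le> X'"
  shows "contour_integral (closed_loop g X') f = contour_integral (closed_loop g X) f"
proof -
  obtain h where h: "\<And>x. x \<in> C \<Longrightarrow> (h has_field_derivative f x) (at x within C)"
    using holomorphic_convex_primitive'[OF C(2,3,1)] by blast
  have prim: "contour_integral (linepath u v) f = h v - h u" if "u \<in> C" "v \<in> C" for u v
    using contour_integral_primitive[OF h, of "linepath u v"] closed_segment_subset[OF that C(2)]
    by (auto intro!: contour_integral_unique)
  have c: "continuous_on (closed_segment (P0 X') s0) f" "continuous_on (closed_segment s1 (P1 X')) f"
    using f(1) sub(2) unfolding path_image_closed_loop
    by (auto intro!: holomorphic_on_imp_continuous_on holomorphic_on_subset[OF f(1)])
  show ?thesis
    unfolding contour_integral_closed_loop[OF f sub(1)] contour_integral_closed_loop[OF f sub(2)]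
    using C(4) contour_integral_split_linepath[OF c(1) P_in_segment(1)[OF X]]
      contour_integral_split_linepath[OF c(2) P_in_segment(2)[OF X]]
    by (simp add: prim)
qed

text \<open>To replace "eventually" by an explicit threshold, a loop with a far vertical side is
  pulled back to X through the half-plane Re z > Re w, where 1 / (z - w) is holomorphic.\<close>

lemma winding_number_closed_loop:
  assumes ev: "\<forall>\<^sub>F X in at_top. w \<notin> path_image (closed_loop g X) \<and> winding_number (closed_loop g X) w = v"
    and X: "X > X0" "Re w < X"
  shows "w \<notin> path_image (closed_loop g X)" "winding_number (closed_loop g X) w = v"
proof -
  from eventually_conj[OF ev eventually_ge_at_top[of X]]
  obtain X' where X': "w \<notin> path_image (closed_loop g X')" "winding_number (closed_loop g X') w = v" "X \<le> X'"
    using eventually_happens'[OF trivial_limit_at_top_linorder] by blast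
  have "w \<notin> closed_segment (P1 X) (P0 X)" using X(2) Re_vertical by fastforce
  then show nin: "w \<notin> path_image (closed_loop g X)"
    using path_image_closed_loop_mono[OF X(1) X'(3)] X'(1) by blast
  have "contour_integral (closed_loop g X') (\<lambda>z. 1 / (z - w)) = contour_integral (closed_loop g X) (\<lambda>z. 1 / (z - w))"
  proof (rule contour_integral_closed_loop_extend)
    show "(\<lambda>z. 1 / (z - w)) holomorphic_on - {w}" by (auto intro!: holomorphic_intros)
    show "(\<lambda>z. 1 / (z - w)) holomorphic_on {z. Re w < Re z}" by (auto intro!: holomorphic_intros)
    show "convex {z. Re w < Re z}" by (rule convex_halfspace_Re_gt)
    show "open {z. Re w < Re z}" by (rule open_halfspace_Re_gt)
  qed (use nin X X' in auto)
  then show "winding_number (closed_loop g X) w = v"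
    using winding_number_valid_path[OF valid_closed_loop nin]
      winding_number_valid_path[OF valid_closed_loop X'(1)] X'(2) by simp
qed

lemma Re_closed_loop: "X > X0 \<Longrightarrow> s \<in> path_image (closed_loop g X) \<Longrightarrow> Re s \<le> X"
proof -
  assume X: "X > X0" "s \<in> path_image (closed_loop g X)"
  have "closed_segment (P0 X) s0 \<subseteq> {z. Re z \<le> X}" "closed_segment s1 (P1 X) \<subseteq> {z. Re z \<le> X}"
    "closed_segment (P1 X) (P0 X) \<subseteq> {z. Re z \<le> X}"
    using X(1) Re_ends by (intro closed_segment_subset convex_halfspace_Re_le; simp)+
  with X Re_less show ?thesis unfolding path_image_closed_loop by fastforce
qed

lemma winding_number_closed_loop_right:
  assumes "X > X0" "Re w > X"
  shows "w \<notin> path_image (closed_loop g X)" "winding_number (closed_loop g X) w = 0"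
proof -
  show "w \<notin> path_image (closed_loop g X)" using Re_closed_loop[OF assms(1), of w] assms(2) by auto
  show "winding_number (closed_loop g X) w = 0"
    using Re_closed_loop[OF assms(1)] assms(2)
    by (intro winding_number_zero_outside[of _ "{z. Re z \<le> X}"] valid_path_imp_path
          valid_closed_loop convex_halfspace_Re_le loop_closed_loop) auto
qed

end

section \<open>Enumeration of the poles\<close>

lemma card_nat_interval_le:
  fixes l w :: real
  assumes "w \<ge> 0"
  shows "finite {k::nat. l \<le> real k \<and> real k \<le> l + w}"
    and "card {k::nat. l \<le> real k \<and> real k \<le> l + w} \<le> nat \<lfloor>w\<rfloor> + 1"
proof -
  have sub: "{k::nat. l \<le> real k \<and> real k \<le> l + w} \<subseteq> {nat \<lceil>l\<rceil>..nat \<lceil>l\<rceil> + nat \<lfloor>w\<rfloor>}"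
  proof safe
    fix k :: nat assume k: "l \<le> real k" "real k \<le> l + w"
    show "k \<in> {nat \<lceil>l\<rceil>..nat \<lceil>l\<rceil> + nat \<lfloor>w\<rfloor>}"
      using k assms by (simp add: nat_le_iff ceiling_le_iff) linarith
  qed
  show "finite {k::nat. l \<le> real k \<and> real k \<le> l + w}" using sub by (rule finite_subset) simp
  show "card {k::nat. l \<le> real k \<and> real k \<le> l + w} \<le> nat \<lfloor>w\<rfloor> + 1"
    using card_mono[OF _ sub] by simp
qed

context fox_parameters
begin

lemma Re_a_pole: "Re (a_pole i k) = (1 - Re (a i) + real k) / \<alpha> i"
  and Im_a_pole: "Im (a_pole i k) = Im (a_pole i 0)"
  by (simp_all add: fox_a_pole_def)

lemma Re_b_pole: "Re (b_pole j l) = - (Re (b j) + real l) / \<beta> j"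
  by (simp add: fox_b_pole_def)

lemma eventually_Re_a_pole:
  assumes "i \<in> {1..n}"
  shows "\<forall>\<^sub>F k in sequentially. B < Re (a_pole i k)"
proof -
  have "\<forall>\<^sub>F x in at_top. B < (c + x) / d" if "d > 0" for B c d :: real
    using that by real_asymp
  from this[OF \<alpha>_pos'[OF assms]] show ?thesis
    unfolding Re_a_pole by (rule eventually_compose_filterlim[OF _ filterlim_real_sequentially])
qed

lemma finite_a_pairs: "finite {(i, k). i \<in> {1..n} \<and> Re (a_pole i k) < X}"
proof (rule finite_subset)
  show "{(i, k). i \<in> {1..n} \<and> Re (a_pole i k) < X} \<subseteq>
          (SIGMA i:{1..n}. {..nat \<lceil>\<alpha> i * X + Re (a i) - 1\<rceil>})"
  proof safe
    fix i k assume i: "i \<in> {1..n}" and "Re (a_pole i k) < X"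
    then have "1 - Re (a i) + real k < X * \<alpha> i"
      using \<alpha>_pos'[OF i] unfolding Re_a_pole by (subst (asm) pos_divide_less_eq)
    then have "real k \<le> \<alpha> i * X + Re (a i) - 1" by (simp add: mult.commute)
    then show "k \<le> nat \<lceil>\<alpha> i * X + Re (a i) - 1\<rceil>" by linarith
  qed
qed auto

text \<open>Poles as points: a multiple pole occurs once, as in the residue theorem.\<close>

definition "a_poles X = {c. \<exists>i\<in>{1..n}. \<exists>k. c = a_pole i k \<and> Re c < X}"

lemma a_poles_altdef: "a_poles X = (\<lambda>(i, k). a_pole i k) ` {(i, k). i \<in> {1..n} \<and> Re (a_pole i k) < X}"
  by (auto simp: a_poles_def image_iff)

lemma finite_a_poles: "finite (a_poles X)"
  unfolding a_poles_altdef by (intro finite_imageI finite_a_pairs)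

text \<open>Each family runs to the left from - b j / \<beta> j. A sum of absolute values dominates
  all starting abscissae at once and makes sense for m = 0 too.\<close>

lemma Re_b_pole_less: obtains B where "\<And>j l. j \<in> {1..m} \<Longrightarrow> Re (b_pole j l) < B"
proof
  fix j l assume j: "j \<in> {1..m}"
  have "Re (b_pole j l) \<le> - Re (b j) / \<beta> j"
    unfolding Re_b_pole using \<beta>_pos'[OF j] by (intro divide_right_mono) auto
  also have "\<dots> \<le> \<bar>Re (b j) / \<beta> j\<bar>"
    using abs_ge_minus_self[of "Re (b j) / \<beta> j"] by simp
  also have "\<dots> \<le> (\<Sum>j=1..m. \<bar>Re (b j) / \<beta> j\<bar>)" using j by (intro member_le_sum) auto
  finally show "Re (b_pole j l) < (\<Sum>j=1..m. \<bar>Re (b j) / \<beta> j\<bar>) + 1" by simp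
qed

text \<open>The poles form finitely many arithmetic progressions tending to infinity. This
  finiteness is what the residue theorem requires, and the reason for applying it in a ball.\<close>

lemma finite_irregular: "finite (ball 0 R - regular)"
proof (rule finite_subset)
  show "ball 0 R - regular \<subseteq> a_poles R \<union>
      (\<lambda>(j, l). b_pole j l) ` (SIGMA j:{1..m}. {..nat \<lceil>\<beta> j * R - Re (b j)\<rceil>})"
  proof
    fix s assume s: "s \<in> ball 0 R - regular"
    then have R: "\<bar>Re s\<bar> < R" using abs_Re_le_cmod[of s] by auto
    from s consider i k where "i \<in> {1..n}" "s = a_pole i k" | j l where "j \<in> {1..m}" "s = b_pole j l"
      by (auto simp: regular_def)
    then show "s \<in> a_poles R \<union>
      (\<lambda>(j, l). b_pole j l) ` (SIGMA j:{1..m}. {..nat \<lceil>\<beta> j * R - Re (b j)\<rceil>})"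
    proof cases
      case 1
      with R show ?thesis by (auto simp: a_poles_def)
    next
      case (2 j l)
      have "- R < Re s" using R by linarith
      then have "- R < - (Re (b j) + real l) / \<beta> j" unfolding 2(2) Re_b_pole .
      then have "- R * \<beta> j < - (Re (b j) + real l)"
        using \<beta>_pos'[OF 2(1)] by (subst (asm) pos_less_divide_eq) auto
      then have "real l \<le> \<beta> j * R - Re (b j)" by (simp add: mult.commute)
      then have "l \<le> nat \<lceil>\<beta> j * R - Re (b j)\<rceil>" by linarith
      with 2 show ?thesis by force
    qed
  qed
  show "finite (a_poles R \<union>
      (\<lambda>(j, l). b_pole j l) ` (SIGMA j:{1..m}. {..nat \<lceil>\<beta> j * R - Re (b j)\<rceil>}))"
    by (auto intro!: finite_a_poles)
qed

section \<open>One index pair for every pole, and choice of cutoffs\<close>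

abbreviation "S1 \<equiv> fox_simple_pairs n a \<alpha>"
abbreviation "S2 \<equiv> fox_multiple_pairs n a \<alpha>"

lemma pairs_disjoint: "S1 \<inter> S2 = {}"
  by (auto simp: fox_simple_pairs_def fox_multiple_pairs_def)

text \<open>The only index of a simple pole is also its least one, so both index sets together
  represent every pole by its least index.\<close>

lemma pairs_Un: "S1 \<union> S2 = {(i, k). i \<in> {1..n} \<and> i = Min (idx (a_pole i k))}"
proof -
  have "(i, k) \<in> S1 \<union> S2 \<longleftrightarrow> i \<in> {1..n} \<and> i = Min (idx (a_pole i k))" for i k
  proof (cases "i \<in> {1..n}")
    case True
    then have i: "i \<in> idx (a_pole i k)" by (auto simp: fox_pole_indices_def)
    then have "card (idx (a_pole i k)) > 0" using finite_idx[of "a_pole i k"] by (auto simp: card_gt_0_iff)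
    moreover have "i = Min (idx (a_pole i k))" if "card (idx (a_pole i k)) = 1"
    proof -
      from that i have "idx (a_pole i k) = {i}" by (metis card_1_singletonE singletonD)
      then show ?thesis by simp
    qed
    ultimately show ?thesis using True
      by (cases "card (idx (a_pole i k)) = 1")
         (auto simp: fox_simple_pairs_def fox_multiple_pairs_def fox_N_def)
  qed (auto simp: fox_simple_pairs_def fox_multiple_pairs_def)
  then show ?thesis by auto
qed

text \<open>The least index depends on the pole alone, so equal poles give equal i and then equal
  k.\<close>

lemma inj_on_pairs: "inj_on (\<lambda>(i, k). a_pole i k) (S1 \<union> S2)"
proof (rule inj_onI, clarify)
  fix i k i' k' assume "(i, k) \<in> S1 \<union> S2" "(i', k') \<in> S1 \<union> S2" and eq: "a_pole i k = a_pole i' k'"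
  then have "i \<in> {1..n}" "i = i'" unfolding pairs_Un by auto
  with eq a_pole_inj show "i = i' \<and> k = k'" by blast
qed

lemma a_poles_pairs: "a_poles X = (\<lambda>(i, k). a_pole i k) ` {(i, k). (i, k) \<in> S1 \<union> S2 \<and> Re (a_pole i k) < X}"
proof (intro equalityI subsetI)
  fix c assume "c \<in> a_poles X"
  then obtain i k where i: "i \<in> {1..n}" "c = a_pole i k" "Re c < X" by (auto simp: a_poles_def)
  then have "idx c \<noteq> {}" by (auto simp: fox_pole_indices_def)
  then have M: "Min (idx c) \<in> idx c" using finite_idx by (intro Min_in)
  then obtain k' where k': "c = a_pole (Min (idx c)) k'" by (auto simp: fox_pole_indices_def)
  have "(Min (idx c), k') \<in> S1 \<union> S2"
    unfolding pairs_Un using k' subsetD[OF idx_subset M] by auto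
  with k' i(3) show "c \<in> (\<lambda>(i, k). a_pole i k) ` {(i, k). (i, k) \<in> S1 \<union> S2 \<and> Re (a_pole i k) < X}"
    by (intro image_eqI[of _ _ "(Min (idx c), k')"]) auto
next
  fix c assume "c \<in> (\<lambda>(i, k). a_pole i k) ` {(i, k). (i, k) \<in> S1 \<union> S2 \<and> Re (a_pole i k) < X}"
  then show "c \<in> a_poles X" unfolding pairs_Un a_poles_def by auto
qed

lemma finite_pairs: "finite {(i, k). (i, k) \<in> S1 \<union> S2 \<and> Re (a_pole i k) < X}"
  by (rule finite_subset[OF _ finite_a_pairs[of X]]) (auto simp: pairs_Un)

text \<open>The terms over \<open>S1\<close> and those over \<open>S2\<close> are values of this one
  function, so convergence is studied only for it. The sign is that of the clockwise loop.\<close>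

definition "neg_residue = (\<lambda>(i, k). - residue f (a_pole i k))"

lemma T1_eq_neg_residue: "x \<in> S1 \<Longrightarrow> T1 x = neg_residue x"
  by (auto simp: fox_simple_pairs_def neg_residue_def T1_eq split: prod.splits)

lemma T2_eq_neg_residue: "x \<in> S2 \<Longrightarrow> T2 x = neg_residue x"
  by (auto simp: fox_multiple_pairs_def neg_residue_def T2_eq split: prod.splits)

lemma sum_pairs:
  "(\<Sum>(i, k) | (i, k) \<in> S1 \<and> Re (a_pole i k) < X. T1 (i, k)) +
   (\<Sum>(i, k) | (i, k) \<in> S2 \<and> Re (a_pole i k) < X. T2 (i, k)) =
     sum neg_residue {(i, k). (i, k) \<in> S1 \<union> S2 \<and> Re (a_pole i k) < X}"
  "sum neg_residue {(i, k). (i, k) \<in> S1 \<union> S2 \<and> Re (a_pole i k) < X} = - (\<Sum>c\<in>a_poles X. residue f c)"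
proof -
  let ?A = "\<lambda>S. {(i, k). (i, k) \<in> S \<and> Re (a_pole i k) < X}"
  have "sum neg_residue (?A (S1 \<union> S2)) = sum neg_residue (?A S1 \<union> ?A S2)" by (intro sum.cong) auto
  also have "\<dots> = sum neg_residue (?A S1) + sum neg_residue (?A S2)"
    using pairs_disjoint by (intro sum.union_disjoint finite_subset[OF _ finite_pairs[of X]]) auto
  also have "sum neg_residue (?A S1) = (\<Sum>(i, k) | (i, k) \<in> S1 \<and> Re (a_pole i k) < X. T1 (i, k))"
    by (intro sum.cong) (auto simp: T1_eq_neg_residue)
  also have "sum neg_residue (?A S2) = (\<Sum>(i, k) | (i, k) \<in> S2 \<and> Re (a_pole i k) < X. T2 (i, k))"
    by (intro sum.cong) (auto simp: T2_eq_neg_residue)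
  finally show "(\<Sum>(i, k) | (i, k) \<in> S1 \<and> Re (a_pole i k) < X. T1 (i, k)) +
     (\<Sum>(i, k) | (i, k) \<in> S2 \<and> Re (a_pole i k) < X. T2 (i, k)) = sum neg_residue (?A (S1 \<union> S2))" ..
  have "inj_on (\<lambda>(i, k). a_pole i k) (?A (S1 \<union> S2))"
    by (rule inj_on_subset[OF inj_on_pairs]) auto
  then have "(\<Sum>c\<in>a_poles X. residue f c) = (\<Sum>x\<in>?A (S1 \<union> S2). residue f (case x of (i, k) \<Rightarrow> a_pole i k))"
    unfolding a_poles_pairs by (simp add: sum.reindex comp_def)
  then show "sum neg_residue (?A (S1 \<union> S2)) = - (\<Sum>c\<in>a_poles X. residue f c)"
    by (simp add: neg_residue_def sum_negf case_prod_unfold)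
qed

text \<open>
  Among \<open>K\<close> equidistant candidates in \<open>[\<nu>, \<nu> + 1]\<close> one is far from the fewer than \<open>K\<close> poles nearby.
\<close>

lemma ex_cutoffs: "\<exists>X. fox_cutoffs n a \<alpha> X \<and> (\<forall>\<nu>. real \<nu> \<le> X \<nu> \<and> X \<nu> \<le> real \<nu> + 1)"
proof -
  \<comment> \<open>Consecutive pole abscissae of one family differ by 1 / \<alpha> i, so a window
    of width 3 holds at most \<open>nat \<lfloor>3 * \<alpha> i\<rfloor> + 1\<close> of them;
    \<open>K\<close> exceeds the total by one.\<close>
  define K where "K = Suc (\<Sum>i=1..n. nat \<lfloor>3 * \<alpha> i\<rfloor> + 1)"
  have "K \<ge> 1" by (simp add: K_def)
  then have K: "real K > 0" "real K \<ge> 1" by simp_all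
  have "\<exists>x. real \<nu> \<le> x \<and> x \<le> real \<nu> + 1 \<and> (\<forall>i\<in>{1..n}. \<forall>k. 1 / (2 * real K) \<le> \<bar>x - Re (a_pole i k)\<bar>)" for \<nu>
  proof (rule ccontr)
    assume none: "\<not> ?thesis"
    \<comment> \<open>The window contains every pole abscissa that comes within 1 / (2 * K) \<le> 1
      of a candidate.\<close>
    define W where "W = (SIGMA i:{1..n}. {k. real \<nu> - 1 \<le> Re (a_pole i k) \<and> Re (a_pole i k) \<le> real \<nu> + 2})"
    have "\<exists>w. w \<in> W \<and> \<bar>real \<nu> + real t / real K - Re (a_pole (fst w) (snd w))\<bar> < 1 / (2 * real K)"
      if "t < K" for t
    proof -
      have t: "0 \<le> real t / real K" "real t / real K \<le> 1" using that K by auto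
      with none obtain i k where ik: "i \<in> {1..n}"
        "\<bar>real \<nu> + real t / real K - Re (a_pole i k)\<bar> < 1 / (2 * real K)"
        by (metis add_left_mono add.right_neutral not_le)
      have "1 / (2 * real K) \<le> 1" using K by simp
      then have "real \<nu> - 1 \<le> Re (a_pole i k) \<and> Re (a_pole i k) \<le> real \<nu> + 2"
        using ik(2) t by linarith
      with ik show ?thesis by (intro exI[of _ "(i, k)"]) (auto simp: W_def)
    qed
    then obtain w where w: "\<And>t. t < K \<Longrightarrow> w t \<in> W"
      "\<And>t. t < K \<Longrightarrow> \<bar>real \<nu> + real t / real K - Re (a_pole (fst (w t)) (snd (w t)))\<bar> < 1 / (2 * real K)"
      by metis
    \<comment> \<open>Candidates are at least 1 / K apart, so no abscissa is closer than 1 / (2 * K)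
      to two of them.\<close>
    have "inj_on w {..<K}"
    proof (rule inj_onI)
      fix t t' assume t: "t \<in> {..<K}" "t' \<in> {..<K}" "w t = w t'"
      have "\<bar>real t / real K - real t' / real K\<bar> < 1 / (2 * real K) + 1 / (2 * real K)"
        using w(2)[of t] w(2)[of t'] t by simp
      also have "\<dots> = 1 / real K" by simp
      finally have "\<bar>real t - real t'\<bar> < 1"
        using K by (simp add: diff_divide_distrib[symmetric] divide_less_cancel)
      then show "t = t'" by linarith
    qed
    have W: "finite {k. real \<nu> - 1 \<le> Re (a_pole i k) \<and> Re (a_pole i k) \<le> real \<nu> + 2}"
      "card {k. real \<nu> - 1 \<le> Re (a_pole i k) \<and> Re (a_pole i k) \<le> real \<nu> + 2} \<le> nat \<lfloor>3 * \<alpha> i\<rfloor> + 1"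
      if "i \<in> {1..n}" for i
    proof -
      define l where "l = (real \<nu> - 1) * \<alpha> i - 1 + Re (a i)"
      have "{k. real \<nu> - 1 \<le> Re (a_pole i k) \<and> Re (a_pole i k) \<le> real \<nu> + 2} =
            {k. l \<le> real k \<and> real k \<le> l + 3 * \<alpha> i}"
        unfolding Re_a_pole pos_le_divide_eq[OF \<alpha>_pos'[OF that]] pos_divide_le_eq[OF \<alpha>_pos'[OF that]] l_def
        by (intro Collect_cong conj_cong) (auto simp: algebra_simps)
      with card_nat_interval_le[of "3 * \<alpha> i" l] \<alpha>_pos'[OF that]
      show "finite {k. real \<nu> - 1 \<le> Re (a_pole i k) \<and> Re (a_pole i k) \<le> real \<nu> + 2}"
        "card {k. real \<nu> - 1 \<le> Re (a_pole i k) \<and> Re (a_pole i k) \<le> real \<nu> + 2} \<le> nat \<lfloor>3 * \<alpha> i\<rfloor> + 1"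
        by auto
    qed
    have "K = card (w ` {..<K})" using \<open>inj_on w {..<K}\<close> by (simp add: card_image)
    also have "\<dots> \<le> card W"
    proof (rule card_mono)
      show "finite W" unfolding W_def using W(1) by (intro finite_SigmaI) auto
    qed (use w(1) in auto)
    also have "\<dots> = (\<Sum>i=1..n. card {k. real \<nu> - 1 \<le> Re (a_pole i k) \<and> Re (a_pole i k) \<le> real \<nu> + 2})"
      unfolding W_def using W(1) by (intro card_SigmaI) auto
    also have "\<dots> \<le> (\<Sum>i=1..n. nat \<lfloor>3 * \<alpha> i\<rfloor> + 1)" using W(2) by (intro sum_mono)
    also have "\<dots> < K" by (simp add: K_def)
    finally show False by simp
  qed
  then obtain X where X: "\<And>\<nu>. real \<nu> \<le> X \<nu>" "\<And>\<nu>. X \<nu> \<le> real \<nu> + 1"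
    "\<And>\<nu> i k. i \<in> {1..n} \<Longrightarrow> 1 / (2 * real K) \<le> \<bar>X \<nu> - Re (a_pole i k)\<bar>"
    by metis
  have "filterlim X at_top sequentially"
    using X(1) by (intro filterlim_at_top_mono[OF filterlim_real_sequentially]) auto
  then have "fox_cutoffs n a \<alpha> X"
    unfolding fox_cutoffs_def using X(3) K by (intro conjI exI[of _ "1 / (2 * real K)"]) auto
  with X(1,2) show ?thesis by blast
qed

end

section \<open>The residue series\<close>

locale fox_decay = fox_parameters +
  assumes decay_condition: "fox_Delta p q \<alpha> \<beta> < 0 \<or>
         fox_Delta p q \<alpha> \<beta> = 0 \<and> norm (exp \<zeta>) > fox_delta p q \<alpha> \<beta>"
begin

text \<open>The filter statement as a threshold: one \<kappa> and one X1 serve all points of the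
  strip at distance \<epsilon> from the poles, be they on half-lines, vertical sides or small
  circles.\<close>

lemma decay:
  assumes "\<epsilon> > 0"
  obtains \<kappa> X1 where "\<kappa> > 0"
    "\<And>s. \<bar>Im s\<bar> \<le> Y \<Longrightarrow> (\<And>i k. i \<in> {1..n} \<Longrightarrow> \<epsilon> \<le> dist s (a_pole i k)) \<Longrightarrow> X1 \<le> Re s \<Longrightarrow>
       norm (f s) \<le> exp (- \<kappa> * Re s)"
proof -
  define D where "D = {s. \<bar>Im s\<bar> \<le> Y \<and> (\<forall>i\<in>{1..n}. \<forall>k. \<epsilon> \<le> dist s (a_pole i k))}"
  define F where "F = inf (filtercomap Re at_top) (principal D)"
  have ev: "eventually P F \<longleftrightarrow> (\<exists>X1. \<forall>s. X1 \<le> Re s \<longrightarrow> s \<in> D \<longrightarrow> P s)" for P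
    by (simp add: F_def eventually_inf_principal eventually_filtercomap_at_top_linorder)
  interpret right_filter F Y
  proof
    show "filterlim Re at_top F" unfolding F_def
      by (rule filterlim_mono[OF filterlim_filtercomap order.refl inf_le1])
    show "\<forall>\<^sub>F s in F. \<bar>Im s\<bar> \<le> Y" unfolding ev by (auto simp: D_def)
  qed
  have far: "\<forall>\<^sub>F s in F. \<forall>k. \<epsilon> \<le> dist s (a_pole i k)" if "i \<in> {1..n}" for i
    unfolding ev using that by (auto simp: D_def)
  from fox_integrand_decay[OF m_le n_le \<alpha>_pos \<beta>_pos decay_condition assms far]
  obtain \<kappa> where "\<kappa> > 0" "\<forall>\<^sub>F s in F. norm (f s) \<le> exp (- \<kappa> * Re s)" by metis
  moreover from this(2) obtain X1 where "\<forall>s. X1 \<le> Re s \<longrightarrow> s \<in> D \<longrightarrow> norm (f s) \<le> exp (- \<kappa> * Re s)"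
    unfolding ev by blast
  ultimately show thesis by (intro that[of \<kappa> X1]) (auto simp: D_def)
qed

lemma residue_bound:
  assumes "fox_poles_separated n a \<alpha>"
  shows "\<exists>\<kappa> C X1. \<kappa> > 0 \<and> (\<forall>i\<in>{1..n}. \<forall>k. X1 \<le> Re (a_pole i k) \<longrightarrow>
       norm (residue f (a_pole i k)) \<le> C * exp (- \<kappa> * Re (a_pole i k)))"
proof -
  from assms obtain \<epsilon> where \<epsilon>: "\<epsilon> > 0" and sep: "\<And>i i' k k'. i \<in> {1..n} \<Longrightarrow> i' \<in> {1..n} \<Longrightarrow>
      a_pole i k \<noteq> a_pole i' k' \<Longrightarrow> \<epsilon> \<le> dist (a_pole i k) (a_pole i' k')"
    unfolding fox_poles_separated_def by blast
  \<comment> \<open>As 2 * r \<le> \<epsilon>, the ball of radius 2 * r around a pole contains no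
    other \<open>a_pole\<close>, and points on the circle of radius r keep the distance r from all
    of them.\<close>
  define r where "r = min (\<epsilon> / 2) 1"
  have r: "r > 0" "2 * r \<le> \<epsilon>" "r \<le> 1" using \<epsilon> by (auto simp: r_def)
  \<comment> \<open>The ordinate of a pole depends on i only, so one strip contains all the circles,
    whose radius is at most 1.\<close>
  define Y where "Y = (\<Sum>i=1..n. \<bar>Im (a_pole i 0)\<bar>) + 1"
  have Y: "\<bar>Im (a_pole i k)\<bar> + 1 \<le> Y" if "i \<in> {1..n}" for i k
    unfolding Y_def Im_a_pole[of i k] using that by (intro add_right_mono member_le_sum) auto
  obtain \<kappa> X1 where \<kappa>: "\<kappa> > 0" and bound: "\<And>s. \<bar>Im s\<bar> \<le> Y \<Longrightarrow>
      (\<And>i k. i \<in> {1..n} \<Longrightarrow> r \<le> dist s (a_pole i k)) \<Longrightarrow> X1 \<le> Re s \<Longrightarrow>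
       norm (f s) \<le> exp (- \<kappa> * Re s)"
    using decay[OF r(1), of Y] by blast
  obtain B where B: "\<And>j l. j \<in> {1..m} \<Longrightarrow> Re (b_pole j l) < B" using Re_b_pole_less by blast
  \<comment> \<open>The margins 1 and 2 keep the circle to the right of X1 and the ball to the right
    of every \<open>b_pole\<close>.\<close>
  have "norm (residue f (a_pole i k)) \<le> exp \<kappa> * exp (- \<kappa> * Re (a_pole i k))"
    if i: "i \<in> {1..n}" and ge: "max (X1 + 1) (B + 2) \<le> Re (a_pole i k)" for i k
  proof -
    define c where "c = a_pole i k"
    have reg: "s \<in> regular" if "s \<in> ball c (2 * r)" "s \<noteq> c" for s
    proof -
      have "s \<noteq> a_pole i' k'" if "i' \<in> {1..n}" for i' k'
        using sep[OF i that, of k k'] \<open>s \<in> ball c (2 * r)\<close> \<open>s \<noteq> c\<close> r unfolding c_def by force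
      moreover have "s \<noteq> b_pole j l" if "j \<in> {1..m}" for j l
      proof -
        have "\<bar>Re (c - s)\<bar> < 2 * r" using abs_Re_le_cmod[of "c - s"] \<open>s \<in> ball c (2 * r)\<close> by (simp add: dist_norm)
        then have "Re s > B" using ge r unfolding c_def by simp linarith
        with B[OF that, of l] show ?thesis by auto
      qed
      ultimately show ?thesis by (simp add: regular_def)
    qed
    have "(f has_contour_integral 2 * pi * \<i> * residue f c) (circlepath c r)"
    proof (rule base_residue)
      show "f holomorphic_on ball c (2 * r) - {c}"
        by (rule holomorphic_on_subset[OF f_holomorphic]) (use reg in blast)
    qed (use r in auto)
    then have "norm (2 * pi * \<i> * residue f c) \<le> exp (- \<kappa> * (Re c - 1)) * (2 * pi * r)"
    proof (rule has_contour_integral_bound_circlepath)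
      fix s assume s: "norm (s - c) = r"
      have "\<bar>Re s - Re c\<bar> \<le> r" "\<bar>Im s - Im c\<bar> \<le> r"
        using s abs_Re_le_cmod[of "s - c"] abs_Im_le_cmod[of "s - c"] by auto
      then have s': "Re c - 1 \<le> Re s" "\<bar>Im s\<bar> \<le> Y" using r Y[OF i, of k] unfolding c_def by linarith+
      have "norm (f s) \<le> exp (- \<kappa> * Re s)"
      proof (rule bound)
        show "X1 \<le> Re s" using s' ge unfolding c_def by linarith
        show "r \<le> dist s (a_pole i' k')" if "i' \<in> {1..n}" for i' k'
        proof (cases "a_pole i' k' = c")
          case False
          then have "\<epsilon> \<le> dist c (a_pole i' k')" using sep[OF i that] unfolding c_def by metis
          also have "\<dots> \<le> dist s c + dist s (a_pole i' k')" by (metis dist_commute dist_triangle)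
          finally show ?thesis using s r by (simp add: dist_norm)
        qed (use s in \<open>simp add: dist_norm\<close>)
      qed (use s' in auto)
      also have "\<dots> \<le> exp (- \<kappa> * (Re c - 1))" using s' \<kappa> by simp
      finally show "norm (f s) \<le> exp (- \<kappa> * (Re c - 1))" .
    qed (use r in auto)
    then have "norm (residue f c) \<le> exp (- \<kappa> * (Re c - 1)) * r"
      by (simp add: norm_mult)
    also have "\<dots> \<le> exp (- \<kappa> * (Re c - 1)) * 1" using r by (intro mult_left_mono) auto
    also have "\<dots> = exp \<kappa> * exp (- \<kappa> * Re c)" by (simp add: algebra_simps flip: exp_add)
    finally show ?thesis unfolding c_def .
  qed
  with \<kappa> show ?thesis
    by (intro exI[of _ \<kappa>] exI[of _ "exp \<kappa>"] exI[of _ "max (X1 + 1) (B + 2)"] conjI ballI allI impI)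
qed

text \<open>The real part of a pole is linear in k with slope 1 / \<alpha> i, so
  \<open>residue_bound\<close> gives a geometric majorant for each of the n families.\<close>

lemma neg_residue_summable:
  assumes "fox_poles_separated n a \<alpha>" and "S \<subseteq> {1..n} \<times> UNIV"
  shows "neg_residue summable_on S"
proof -
  obtain \<kappa> C X1 where \<kappa>: "\<kappa> > 0" and "\<forall>i\<in>{1..n}. \<forall>k. X1 \<le> Re (a_pole i k) \<longrightarrow>
       norm (residue f (a_pole i k)) \<le> C * exp (- \<kappa> * Re (a_pole i k))"
    using residue_bound[OF assms(1)] by blast
  note bound = this(2)[rule_format]
  have "summable (\<lambda>k. norm (neg_residue (i, k)))" if i: "i \<in> {1..n}" for i
  proof (rule summable_comparison_test_ev)
    define u where "u = \<kappa> / \<alpha> i"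
    have u: "u > 0" using \<kappa> \<alpha>_pos'[OF i] by (simp add: u_def)
    define M where "M = C * exp (- (u * (1 - Re (a i))))"
    from eventually_Re_a_pole[OF i, of X1] show "\<forall>\<^sub>F k in sequentially. norm (norm (neg_residue (i, k))) \<le> M * exp (- u) ^ k"
    proof eventually_elim
      case (elim k)
      have "- \<kappa> * Re (a_pole i k) = - (u * (1 - Re (a i))) + real k * - u"
        by (simp add: Re_a_pole u_def add_divide_distrib diff_divide_distrib algebra_simps)
      then have "exp (- \<kappa> * Re (a_pole i k)) = exp (- (u * (1 - Re (a i)))) * exp (- u) ^ k"
        by (simp only: exp_add exp_of_nat_mult)
      with bound[OF i less_imp_le[OF elim]] show ?case by (simp add: neg_residue_def M_def mult.assoc)
    qed
    show "summable (\<lambda>k. M * exp (- u) ^ k)" using u by (intro summable_mult summable_geometric) auto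
  qed
  then have "(\<lambda>k. norm (neg_residue (i, k))) summable_on UNIV" if "i \<in> {1..n}" for i
    using that by (subst summable_on_UNIV_nonneg_real_iff) auto
  then have "(\<lambda>x. norm (neg_residue x)) summable_on ({1..n} \<times> UNIV)"
    by (subst Infinite_Sum.abs_summable_on_Sigma_iff) auto
  then have "(\<lambda>x. norm (neg_residue x)) summable_on S" using assms(2) by (rule summable_on_subset_banach)
  then show ?thesis by (rule abs_summable_summable)
qed

end

section \<open>From closed loops to the contour\<close>

locale fox_loop = fox_decay +
  fixes g :: "real \<Rightarrow> complex"
  assumes contour: "fox_contour m n a \<alpha> b \<beta> g"
begin

definition "X0 = (SOME X0. \<forall>s\<in>path_image g. Re s < X0)"

lemma valid_g: "valid_path g"
  using contour by (simp add: fox_contour_def is_right_loop_def)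

sublocale right_loop g X0
proof
  have "bounded (path_image g)"
    using valid_g by (intro compact_imp_bounded compact_path_image valid_path_imp_path)
  then obtain B where B: "\<And>s. s \<in> path_image g \<Longrightarrow> norm s \<le> B" unfolding bounded_iff by blast
  have "\<forall>s\<in>path_image g. Re s < B + 1"
    using B complex_Re_le_cmod by (force intro: le_less_trans)
  then have "\<forall>s\<in>path_image g. Re s < X0" unfolding X0_def by (rule someI)
  then show "Re s < X0" if "s \<in> path_image g" for s using that by blast
qed (rule valid_g)

lemma winding_a_pole:
  assumes "i \<in> {1..n}" "X > X0" "Re (a_pole i k) < X"
  shows "a_pole i k \<notin> path_image (closed_loop g X)" "winding_number (closed_loop g X) (a_pole i k) = -1"
proof -
  have "\<forall>\<^sub>F X in at_top. a_pole i k \<notin> path_image (closed_loop g X) \<and> winding_number (closed_loop g X) (a_pole i k) = -1"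
    using contour assms(1) by (simp add: fox_contour_def right_of_loop_def)
  from winding_number_closed_loop[OF this assms(2,3)]
  show "a_pole i k \<notin> path_image (closed_loop g X)" "winding_number (closed_loop g X) (a_pole i k) = -1" .
qed

lemma winding_b_pole:
  assumes "j \<in> {1..m}" "X > X0" "Re (b_pole j l) < X"
  shows "b_pole j l \<notin> path_image (closed_loop g X)" "winding_number (closed_loop g X) (b_pole j l) = 0"
proof -
  have "\<forall>\<^sub>F X in at_top. b_pole j l \<notin> path_image (closed_loop g X) \<and> winding_number (closed_loop g X) (b_pole j l) = 0"
    using contour assms(1) by (simp add: fox_contour_def left_of_loop_def)
  from winding_number_closed_loop[OF this assms(2,3)]
  show "b_pole j l \<notin> path_image (closed_loop g X)" "winding_number (closed_loop g X) (b_pole j l) = 0" .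
qed

lemma closed_loop_regular:
  assumes "X > X0" "s \<in> path_image (closed_loop g X)" "Re s < X"
  shows "s \<in> regular"
  using assms winding_a_pole(1) winding_b_pole(1) unfolding regular_def by blast

lemma half_line_regular:
  assumes "t \<ge> 0"
  shows "s0 + of_real t \<in> regular" "s1 + of_real t \<in> regular"
proof -
  define X where "X = X0 + t + 1"
  have X: "X > X0" "Re s0 + t < X" "Re s1 + t < X" using assms Re_ends by (auto simp: X_def)
  show "s0 + of_real t \<in> regular"
    using X assms Re_ends
    by (intro closed_loop_regular[OF X(1)])
       (auto simp: path_image_closed_loop closed_segment_same_Im closed_segment_eq_real_ivl)
  show "s1 + of_real t \<in> regular"
    using X assms Re_ends
    by (intro closed_loop_regular[OF X(1)])
       (auto simp: path_image_closed_loop closed_segment_same_Im closed_segment_eq_real_ivl)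
qed

text \<open>The poles of one family share an ordinate and run to the right, so a half-line at that
  height would meet one of them.\<close>

lemma Im_ends_a_pole:
  assumes i: "i \<in> {1..n}" and s: "s \<in> {s0, s1}"
  shows "Im s \<noteq> Im (a_pole i 0)"
proof
  assume eq: "Im s = Im (a_pole i 0)"
  obtain k where k: "X0 < Re (a_pole i k)"
    using eventually_happens'[OF sequentially_bot eventually_Re_a_pole[OF i]] by blast
  define t where "t = Re (a_pole i k) - Re s"
  have "t \<ge> 0" using s k Re_ends by (auto simp: t_def)
  have "a_pole i k = s + of_real t"
    using eq Im_a_pole[of i k] by (simp add: complex_eq_iff t_def)
  with half_line_regular[OF \<open>t \<ge> 0\<close>] s have "a_pole i k \<in> regular" by auto
  with i show False by (auto simp: regular_def)
qed

lemma path_image_regular: "path_image g \<subseteq> regular"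
proof
  fix s assume "s \<in> path_image g"
  with Re_less[OF this] show "s \<in> regular"
    by (intro closed_loop_regular[of "X0 + 1"]) (auto simp: path_image_closed_loop)
qed

lemma half_line_decay:
  assumes s: "s \<in> {s0, s1}"
  obtains \<kappa> C T0 where "\<kappa> > 0" "T0 \<ge> 0"
    "\<And>t. t \<ge> T0 \<Longrightarrow> norm (f (s + of_real t)) \<le> C * exp (- \<kappa> * t)"
proof -
  \<comment> \<open>There are only finitely many pole ordinates, so the minimum is positive;
    inserting 1 covers n = 0.\<close>
  define \<epsilon> where "\<epsilon> = Min (insert 1 ((\<lambda>i. \<bar>Im s - Im (a_pole i 0)\<bar>) ` {1..n}))"
  have "\<epsilon> > 0"
    using Im_ends_a_pole[OF _ s] unfolding \<epsilon>_def by (subst Min_gr_iff) auto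
  moreover have "\<epsilon> \<le> \<bar>Im s - Im (a_pole i 0)\<bar>" if "i \<in> {1..n}" for i
    unfolding \<epsilon>_def using that by (intro Min_le) auto
  ultimately have \<epsilon>: "\<epsilon> > 0" "\<And>i. i \<in> {1..n} \<Longrightarrow> \<epsilon> \<le> \<bar>Im s - Im (a_pole i 0)\<bar>"
    by blast+
  obtain \<kappa> X1 where \<kappa>: "\<kappa> > 0" and bound: "\<And>w. \<bar>Im w\<bar> \<le> \<bar>Im s\<bar> \<Longrightarrow>
      (\<And>i k. i \<in> {1..n} \<Longrightarrow> \<epsilon> \<le> dist w (a_pole i k)) \<Longrightarrow> X1 \<le> Re w \<Longrightarrow>
       norm (f w) \<le> exp (- \<kappa> * Re w)"
    using decay[OF \<epsilon>(1), of "\<bar>Im s\<bar>"] by blast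
  have "norm (f (s + of_real t)) \<le> exp (- \<kappa> * Re s) * exp (- \<kappa> * t)" if "t \<ge> max 0 (X1 - Re s)" for t
  proof -
    have "norm (f (s + of_real t)) \<le> exp (- \<kappa> * Re (s + of_real t))"
    proof (rule bound)
      fix i k assume i: "i \<in> {1..n}"
      have "\<epsilon> \<le> \<bar>Im (s + of_real t - a_pole i k)\<bar>" using \<epsilon>(2)[OF i] Im_a_pole[of i k] by simp
      also have "\<dots> \<le> dist (s + of_real t) (a_pole i k)" unfolding dist_norm by (rule abs_Im_le_cmod)
      finally show "\<epsilon> \<le> dist (s + of_real t) (a_pole i k)" .
    qed (use that in auto)
    also have "\<dots> = exp (- \<kappa> * Re s) * exp (- \<kappa> * t)" by (simp add: algebra_simps flip: exp_add)
    finally show ?thesis .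
  qed
  with \<kappa> that[of \<kappa> "max 0 (X1 - Re s)"] show thesis by auto
qed

lemma half_line:
  assumes s: "s \<in> {s0, s1}"
  shows "(\<lambda>t. f (s + of_real t)) integrable_on {0..}"
    and "((\<lambda>T. integral {0..T} (\<lambda>t. f (s + of_real t))) \<longlongrightarrow> integral {0..} (\<lambda>t. f (s + of_real t))) at_top"
proof -
  obtain \<kappa> C T0 where d: "\<kappa> > 0" "T0 \<ge> 0"
    "\<And>t. t \<ge> T0 \<Longrightarrow> norm (f (s + of_real t)) \<le> C * exp (- \<kappa> * t)"
    using half_line_decay[OF s] by blast
  have "continuous_on {0..} (\<lambda>t. f (s + of_real t))"
    using half_line_regular s
    by (intro continuous_on_compose2[OF holomorphic_on_imp_continuous_on[OF f_holomorphic]] continuous_intros) auto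
  from half_line_integral[OF this d] show "(\<lambda>t. f (s + of_real t)) integrable_on {0..}"
    "((\<lambda>T. integral {0..T} (\<lambda>t. f (s + of_real t))) \<longlongrightarrow> integral {0..} (\<lambda>t. f (s + of_real t))) at_top"
    by auto
qed

lemma loop_integrable_f: "loop_integrable f g"
  unfolding loop_integrable_def
  using half_line(1) contour_integrable_holomorphic_simple[OF f_holomorphic open_regular valid path_image_regular]
  by auto

lemma contour_integral_residues:
  assumes X: "X > X0" and b_less: "\<And>j l. j \<in> {1..m} \<Longrightarrow> Re (b_pole j l) < X"
    and a_neq: "\<And>i k. i \<in> {1..n} \<Longrightarrow> Re (a_pole i k) \<noteq> X"
  shows "path_image (closed_loop g X) \<subseteq> regular"
    and "contour_integral (closed_loop g X) f = - (2 * pi * \<i> * (\<Sum>c\<in>a_poles X. residue f c))"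
proof -
  show sub: "path_image (closed_loop g X) \<subseteq> regular"
  proof
    fix s assume s: "s \<in> path_image (closed_loop g X)"
    show "s \<in> regular"
    proof (cases "Re s = X")
      case True
      with b_less a_neq show ?thesis unfolding regular_def by (fastforce simp: less_le)
    next
      case False
      with Re_closed_loop[OF X s] show ?thesis by (intro closed_loop_regular[OF X s]) auto
    qed
  qed
  have "bounded (path_image (closed_loop g X) \<union> a_poles X)"
    using finite_a_poles[of X] valid_path_imp_path[OF valid_closed_loop]
    by (auto intro: compact_imp_bounded compact_path_image finite_imp_bounded)
  \<comment> \<open>The ball contains the loop and the poles to the left of its vertical side;
    outside it, all winding numbers vanish.\<close>
  then obtain r where r: "path_image (closed_loop g X) \<union> a_poles X \<subseteq> ball 0 r"
    using bounded_subset_ballD by blast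
  define pts where "pts = ball 0 r - regular"
  have "contour_integral (closed_loop g X) f =
      2 * pi * \<i> * (\<Sum>p\<in>pts. winding_number (closed_loop g X) p * residue f p)"
  proof (rule Residue_theorem)
    show "open (ball (0::complex) r)" "connected (ball (0::complex) r)" by auto
    show "finite pts" unfolding pts_def by (rule finite_irregular)
    show "f holomorphic_on ball 0 r - pts"
      unfolding pts_def by (rule holomorphic_on_subset[OF f_holomorphic]) auto
    show "path_image (closed_loop g X) \<subseteq> ball 0 r - pts" using r sub by (auto simp: pts_def)
    show "\<forall>z. z \<notin> ball 0 r \<longrightarrow> winding_number (closed_loop g X) z = 0"
      using r valid_path_imp_path[OF valid_closed_loop] loop_closed_loop
      by (auto intro!: winding_number_zero_outside[of _ "ball 0 r"])
  qed (rule valid_closed_loop loop_closed_loop)+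
  \<comment> \<open>The winding number is -1 at each \<open>a_pole\<close> to the left of the
    vertical side, and 0 at those to the right and at each \<open>b_pole\<close>.\<close>
  also have "(\<Sum>p\<in>pts. winding_number (closed_loop g X) p * residue f p) = (\<Sum>p\<in>a_poles X. - residue f p)"
  proof (rule sum.mono_neutral_cong_right)
    show "finite pts" unfolding pts_def by (rule finite_irregular)
    show "a_poles X \<subseteq> pts" using r by (auto simp: pts_def regular_def a_poles_def)
    show "winding_number (closed_loop g X) p * residue f p = - residue f p" if "p \<in> a_poles X" for p
      using that winding_a_pole(2)[OF _ X] by (auto simp: a_poles_def)
    have "winding_number (closed_loop g X) p = 0" if p: "p \<in> pts - a_poles X" for p
    proof -
      from p consider i k where "i \<in> {1..n}" "p = a_pole i k" | j l where "j \<in> {1..m}" "p = b_pole j l"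
        by (auto simp: pts_def regular_def)
      then show ?thesis
      proof cases
        case 1
        with p have "\<not> Re p < X" by (auto simp: a_poles_def)
        with a_neq[OF 1(1)] 1(2) have "Re p > X" by (metis linorder_neqE_linordered_idom)
        then show ?thesis by (rule winding_number_closed_loop_right(2)[OF X])
      next
        case 2
        with winding_b_pole(2)[OF 2(1) X b_less] show ?thesis by simp
      qed
    qed
    then show "\<forall>p\<in>pts - a_poles X. winding_number (closed_loop g X) p * residue f p = 0" by simp
  qed
  finally show "contour_integral (closed_loop g X) f = - (2 * pi * \<i> * (\<Sum>c\<in>a_poles X. residue f c))"
    by (simp add: sum_negf)
qed

lemma residue_sums_tendsto:
  assumes "fox_cutoffs n a \<alpha> X"
  shows "(\<lambda>\<nu>. - (\<Sum>c\<in>a_poles (X \<nu>). residue f c)) \<longlonglongrightarrow> fox_H m n p q a \<alpha> b \<beta> g \<zeta>"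
proof -
  from assms obtain \<epsilon> where lim: "filterlim X at_top sequentially" and \<epsilon>: "\<epsilon> > 0"
    and far: "\<And>\<nu> i k. i \<in> {1..n} \<Longrightarrow> \<epsilon> \<le> \<bar>X \<nu> - Re (a_pole i k)\<bar>"
    unfolding fox_cutoffs_def by blast
  define Y where "Y = max \<bar>Im s0\<bar> \<bar>Im s1\<bar>"
  obtain \<kappa> X1 where \<kappa>: "\<kappa> > 0" and bound: "\<And>w. \<bar>Im w\<bar> \<le> Y \<Longrightarrow>
      (\<And>i k. i \<in> {1..n} \<Longrightarrow> \<epsilon> \<le> dist w (a_pole i k)) \<Longrightarrow> X1 \<le> Re w \<Longrightarrow>
       norm (f w) \<le> exp (- \<kappa> * Re w)"
    using decay[OF \<epsilon>, of Y] by blast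
  obtain B where B: "\<And>j l. j \<in> {1..m} \<Longrightarrow> Re (b_pole j l) < B" using Re_b_pole_less by blast
  define V where "V = (\<lambda>x. contour_integral (linepath (P1 x) (P0 x)) f)"
  \<comment> \<open>From here on the vertical side lies to the right of \<open>g\<close> and of
    every \<open>b_pole\<close>, and the decay bound holds on it.\<close>
  have ev: "\<forall>\<^sub>F \<nu> in sequentially. X \<nu> > max X0 (max B X1)"
    using lim unfolding filterlim_at_top_dense by blast
  have loop: "path_image (closed_loop g (X \<nu>)) \<subseteq> regular"
    "contour_integral (closed_loop g (X \<nu>)) f = - (2 * pi * \<i> * (\<Sum>c\<in>a_poles (X \<nu>). residue f c))"
    if "X \<nu> > max X0 (max B X1)" for \<nu>
  proof -
    have "Re (b_pole j l) < X \<nu>" if "j \<in> {1..m}" for j l using B[OF that, of l] \<open>X \<nu> > _\<close> by simp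
    moreover have "Re (a_pole i k) \<noteq> X \<nu>" if "i \<in> {1..n}" for i k using far[OF that, of \<nu> k] \<epsilon> by auto
    moreover have "X \<nu> > X0" using that by simp
    ultimately show "path_image (closed_loop g (X \<nu>)) \<subseteq> regular"
      "contour_integral (closed_loop g (X \<nu>)) f = - (2 * pi * \<i> * (\<Sum>c\<in>a_poles (X \<nu>). residue f c))"
      using contour_integral_residues[of "X \<nu>"] by blast+
  qed
  \<comment> \<open>The vertical sides have constant length, so the decay of the integrand makes
    their contribution vanish.\<close>
  have "\<forall>\<^sub>F \<nu> in sequentially. norm (V (X \<nu>)) \<le> exp (- \<kappa> * X \<nu>) * \<bar>Im s0 - Im s1\<bar>"
    using ev
  proof eventually_elim
    case (elim \<nu>)
    have "norm (V (X \<nu>)) \<le> exp (- \<kappa> * X \<nu>) * norm (P0 (X \<nu>) - P1 (X \<nu>))"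
      unfolding V_def
    proof (rule contour_integral_bound_linepath)
      show "f contour_integrable_on linepath (P1 (X \<nu>)) (P0 (X \<nu>))"
        using loop(1)[OF elim] unfolding path_image_closed_loop
        by (intro contour_integrable_holomorphic_simple[OF f_holomorphic open_regular]) auto
      fix s assume s: "s \<in> closed_segment (P1 (X \<nu>)) (P0 (X \<nu>))"
      then have Re: "Re s = X \<nu>" by (rule Re_vertical)
      have "closed_segment (P1 (X \<nu>)) (P0 (X \<nu>)) \<subseteq> {s. - Y \<le> Im s} \<inter> {s. Im s \<le> Y}"
        by (intro closed_segment_subset convex_Int convex_halfspace_Im_ge convex_halfspace_Im_le)
           (auto simp: Y_def)
      with s have "- Y \<le> Im s" "Im s \<le> Y" by auto
      then have Im: "\<bar>Im s\<bar> \<le> Y" by linarith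
      have "norm (f s) \<le> exp (- \<kappa> * Re s)"
      proof (rule bound[OF Im])
        fix i k assume "i \<in> {1..n}"
        from far[OF this, of \<nu> k] Re have "\<epsilon> \<le> \<bar>Re (s - a_pole i k)\<bar>" by simp
        also have "\<dots> \<le> dist s (a_pole i k)" unfolding dist_norm by (rule abs_Re_le_cmod)
        finally show "\<epsilon> \<le> dist s (a_pole i k)" .
      qed (use elim Re in auto)
      then show "norm (f s) \<le> exp (- \<kappa> * X \<nu>)" by (simp add: Re)
    qed auto
    also have "norm (P0 (X \<nu>) - P1 (X \<nu>)) = \<bar>Im s0 - Im s1\<bar>"
      by (simp add: cmod_def)
    finally show ?case .
  qed
  moreover have "((\<lambda>x. exp (- \<kappa> * x) * c) \<longlongrightarrow> 0) at_top" for c using \<kappa> by real_asymp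
  from filterlim_compose[OF this lim]
  have "(\<lambda>\<nu>. exp (- \<kappa> * X \<nu>) * \<bar>Im s0 - Im s1\<bar>) \<longlonglongrightarrow> 0" .
  ultimately have V: "(\<lambda>\<nu>. V (X \<nu>)) \<longlonglongrightarrow> 0" by (rule Lim_null_comparison)
  have half: "(\<lambda>\<nu>. integral {0..X \<nu> - Re s} (\<lambda>t. f (s + of_real t))) \<longlonglongrightarrow> integral {0..} (\<lambda>t. f (s + of_real t))"
    if "s \<in> {s0, s1}" for s
  proof (rule filterlim_compose[OF half_line(2)[OF that]])
    show "filterlim (\<lambda>\<nu>. X \<nu> - Re s) at_top sequentially"
      by (rule filterlim_compose[OF _ lim]) real_asymp
  qed
  \<comment> \<open>\<open>Q\<close> is the split integral over the closed loop; it is defined for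
    all \<nu> but equals that integral only eventually.\<close>
  define Q where "Q = (\<lambda>\<nu>. - integral {0..X \<nu> - Re s0} (\<lambda>t. f (s0 + of_real t)) + contour_integral g f +
     integral {0..X \<nu> - Re s1} (\<lambda>t. f (s1 + of_real t)) + V (X \<nu>))"
  have "Q \<longlonglongrightarrow> - integral {0..} (\<lambda>t. f (s0 + of_real t)) + contour_integral g f +
     integral {0..} (\<lambda>t. f (s1 + of_real t)) + 0"
    unfolding Q_def using half V by (intro tendsto_intros) auto
  then have "Q \<longlonglongrightarrow> loop_integral f g" by (simp add: loop_integral_def)
  then have "(\<lambda>\<nu>. 1 / (2 * of_real pi * \<i>) * Q \<nu>) \<longlonglongrightarrow> fox_H m n p q a \<alpha> b \<beta> g \<zeta>"
    unfolding fox_H_def by (rule tendsto_mult_left)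
  moreover have "\<forall>\<^sub>F \<nu> in sequentially. 1 / (2 * of_real pi * \<i>) * Q \<nu> = - (\<Sum>c\<in>a_poles (X \<nu>). residue f c)"
    using ev
  proof eventually_elim
    case (elim \<nu>)
    have "Q \<nu> = contour_integral (closed_loop g (X \<nu>)) f"
      using contour_integral_closed_loop'[OF f_holomorphic open_regular loop(1)[OF elim]] elim
      by (simp add: Q_def V_def)
    also note loop(2)[OF elim]
    finally show ?case by simp
  qed
  ultimately show ?thesis by (rule Lim_transform_eventually)
qed

text \<open>An unconditional sum is the limit along every exhaustion by finite sets. The cutoffs
  from \<open>ex_cutoffs\<close> give such an exhaustion, and along it
  \<open>residue_sums_tendsto\<close> identifies the limit.\<close>

lemma residue_series:
  assumes "fox_poles_separated n a \<alpha>"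
  shows "T1 summable_on S1" "T2 summable_on S2"
    "fox_H m n p q a \<alpha> b \<beta> g \<zeta> = infsum T1 S1 + infsum T2 S2"
proof -
  have sub: "S1 \<union> S2 \<subseteq> {1..n} \<times> UNIV" unfolding pairs_Un by auto
  have sR: "neg_residue summable_on S1" "neg_residue summable_on S2" "neg_residue summable_on (S1 \<union> S2)"
    using sub by (auto intro!: neg_residue_summable[OF assms])
  show "T1 summable_on S1" using sR(1) summable_on_cong[of S1 T1 neg_residue] T1_eq_neg_residue by auto
  show "T2 summable_on S2" using sR(2) summable_on_cong[of S2 T2 neg_residue] T2_eq_neg_residue by auto
  obtain X where X: "fox_cutoffs n a \<alpha> X" using ex_cutoffs by blast
  define A where "A = (\<lambda>\<nu>. {(i, k). (i, k) \<in> S1 \<union> S2 \<and> Re (a_pole i k) < X \<nu>})"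
  have "(neg_residue has_sum infsum neg_residue (S1 \<union> S2)) (S1 \<union> S2)" using sR(3) by (rule has_sum_infsum)
  then have lim: "(sum neg_residue \<longlongrightarrow> infsum neg_residue (S1 \<union> S2)) (finite_subsets_at_top (S1 \<union> S2))"
    by (simp add: has_sum_def)
  have "filterlim A (finite_subsets_at_top (S1 \<union> S2)) sequentially"
    unfolding filterlim_finite_subsets_at_top
  proof safe
    fix G assume G: "finite G" "G \<subseteq> S1 \<union> S2"
    have "filterlim X at_top sequentially" using X by (simp add: fox_cutoffs_def)
    then have "\<forall>x\<in>G. \<forall>\<^sub>F \<nu> in sequentially. Re (a_pole (fst x) (snd x)) < X \<nu>"
      by (simp add: filterlim_at_top_dense)
    then have "\<forall>\<^sub>F \<nu> in sequentially. \<forall>x\<in>G. Re (a_pole (fst x) (snd x)) < X \<nu>"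
      using G(1) by (simp add: eventually_ball_finite)
    then show "\<forall>\<^sub>F \<nu> in sequentially. finite (A \<nu>) \<and> G \<subseteq> A \<nu> \<and> A \<nu> \<subseteq> S1 \<union> S2"
    proof eventually_elim
      case (elim \<nu>)
      have "finite (A \<nu>)" unfolding A_def by (rule finite_pairs)
      with elim G(2) show ?case by (auto simp: A_def)
    qed
  qed
  from filterlim_compose[OF lim this]
  have "(\<lambda>\<nu>. - (\<Sum>c\<in>a_poles (X \<nu>). residue f c)) \<longlonglongrightarrow> infsum neg_residue (S1 \<union> S2)"
    unfolding A_def sum_pairs(2) .
  with residue_sums_tendsto[OF X] have "fox_H m n p q a \<alpha> b \<beta> g \<zeta> = infsum neg_residue (S1 \<union> S2)"
    by (rule LIMSEQ_unique)
  also have "\<dots> = infsum neg_residue S1 + infsum neg_residue S2"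
    using sR pairs_disjoint by (intro infsum_Un_disjoint)
  also have "infsum neg_residue S1 = infsum T1 S1" by (intro infsum_cong) (simp add: T1_eq_neg_residue)
  also have "infsum neg_residue S2 = infsum T2 S2" by (intro infsum_cong) (simp add: T2_eq_neg_residue)
  finally show "fox_H m n p q a \<alpha> b \<beta> g \<zeta> = infsum T1 S1 + infsum T2 S2" .
qed

end

theorem theorem6:
  fixes m n p q :: nat
    and a b :: "nat \<Rightarrow> complex"
    and \<alpha> \<beta> :: "nat \<Rightarrow> real"
    and g :: "real \<Rightarrow> complex"
    and z \<zeta> :: complex
  assumes "m \<le> q" and "n \<le> p"
    and "\<And>i. i \<in> {1..p} \<Longrightarrow> \<alpha> i > 0"
    and "\<And>j. j \<in> {1..q} \<Longrightarrow> \<beta> j > 0"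
    and "\<And>i j k l :: nat. i \<in> {1..n} \<Longrightarrow> j \<in> {1..m} \<Longrightarrow>
           of_real (\<beta> j) * (a i - 1 - of_nat k) \<noteq> of_real (\<alpha> i) * (b j + of_nat l)"
    and "fox_contour m n a \<alpha> b \<beta> g"
    and "fox_Delta p q \<alpha> \<beta> < 0 \<and> z \<noteq> 0 \<or>
         fox_Delta p q \<alpha> \<beta> = 0 \<and> norm z > fox_delta p q \<alpha> \<beta>"
    and "exp \<zeta> = z"
  shows
    "let H = fox_H m n p q a \<alpha> b \<beta> g \<zeta>;
         S1 = fox_simple_pairs n a \<alpha>;
         S2 = fox_multiple_pairs n a \<alpha>;
         T1 = (\<lambda>(i, k). fox_h m n p q a \<alpha> b \<beta> i k *
                 exp ((a i - 1 - of_nat k) / of_real (\<alpha> i) * \<zeta>));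
         T2 = (\<lambda>(i, k). \<Sum>j=0..fox_N n a \<alpha> i k - 1. fox_Hcoeff m n p q a \<alpha> b \<beta> i k j *
                 exp ((a i - 1 - of_nat k) / of_real (\<alpha> i) * \<zeta>) * \<zeta> ^ j)
     in loop_integrable (fox_integrand m n p q a \<alpha> b \<beta> \<zeta>) g \<and>
        (\<forall>X. fox_cutoffs n a \<alpha> X \<longrightarrow>
           (\<lambda>\<nu>. (\<Sum>(i, k) | (i, k) \<in> S1 \<and> Re (fox_a_pole a \<alpha> i k) < X \<nu>. T1 (i, k)) +
                (\<Sum>(i, k) | (i, k) \<in> S2 \<and> Re (fox_a_pole a \<alpha> i k) < X \<nu>. T2 (i, k)))
             \<longlonglongrightarrow> H) \<and>
        (\<exists>X. fox_cutoffs n a \<alpha> X \<and> (\<forall>\<nu>. real \<nu> \<le> X \<nu> \<and> X \<nu> \<le> real \<nu> + 1)) \<and>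
        (fox_poles_separated n a \<alpha> \<longrightarrow>
           T1 summable_on S1 \<and> T2 summable_on S2 \<and> H = infsum T1 S1 + infsum T2 S2)"
proof -
  interpret fox_loop m n p q a b \<alpha> \<beta> \<zeta> g
    using assms by unfold_locales auto
  have "(\<lambda>\<nu>. (\<Sum>(i, k) | (i, k) \<in> S1 \<and> Re (a_pole i k) < X \<nu>. T1 (i, k)) +
             (\<Sum>(i, k) | (i, k) \<in> S2 \<and> Re (a_pole i k) < X \<nu>. T2 (i, k)))
          \<longlonglongrightarrow> fox_H m n p q a \<alpha> b \<beta> g \<zeta>" if "fox_cutoffs n a \<alpha> X" for X
    unfolding sum_pairs using residue_sums_tendsto[OF that] .
  with loop_integrable_f ex_cutoffs residue_series show ?thesis
    unfolding Let_def T1_def[symmetric] T2_def[symmetric] by blast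
qed

end
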